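(* Let $G$ be a finite group and let $p$ be a prime. Then the following are equivalent: (1) $G$ is $p$-nilpotent. (2) $\varphi(K)\neq 0$ for each $p'$-reduced section $K$ of $G$. (3) For every $p$-centric $p$-subgroup $Q$ of $G$, $\varphi(K)\neq 0$ for each $p'$-reduced section $K$ of $N_G(Q)$. (4) For every $p$-subgroup $Q$ of $G$ that is both $p$-centric and $p$-radical, $\varphi(K)\neq 0$ for each $p'$-reduced section $K$ of $N_G(Q)$.
   Context: For a finite group $K$, $\varphi(K)=|\{g\in K : o(g)=\exp(K)\}|$, the number of elements of $K$ whose order equals the exponent of $K$. A section of a group $G$ is a quotient $A/B$ of a subgroup $A\leq G$ by a normal subgroup $B$ of $A$. For a prime $p$ and a finite group $K$, $O_{p'}(K)$ denotes the largest normal subgroup of $K$ of order prime to $p$, and $O_p(K)$ the largest normal $p$-subgroup of $K$. $K$ is called $p'$-reduced if $O_{p'}(K)=1$, and $p$-reduced if $O_p(K)=1$. $G$ is $p$-nilpotent if it has a normal $p$-complement, i.e. $G=O_{p'}(G)S$ for $S$ a Sylow $p$-subgroup of $G$. A $p$-subgroup $Q$ of $G$ is $p$-centric if $Z(Q)$ is a Sylow $p$-subgroup of $C_G(Q)$, and it is $p$-radical if $N_G(Q)/Q$ is $p$-reduced, i.e. $O_p(N_G(Q)/Q)=1$. *)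

theory Defs
  imports "HOL-Algebra.Algebra"
begin

definition group_exponent :: "('a, 'b) monoid_scheme \<Rightarrow> nat" where
  "group_exponent K = (LEAST n. n > 0 \<and> (\<forall>g \<in> carrier K. g [^]\<^bsub>K\<^esub> n = \<one>\<^bsub>K\<^esub>))"

definition phi :: "('a, 'b) monoid_scheme \<Rightarrow> nat" where
  "phi K = card {g \<in> carrier K. group.ord K g = group_exponent K}"

definition sections :: "('a, 'b) monoid_scheme \<Rightarrow> ('a set) monoid set" where
  "sections G = {G\<lparr>carrier := A\<rparr> Mod B | A B. subgroup A G \<and> B \<lhd> G\<lparr>carrier := A\<rparr>}"

definition p_power_order :: "nat \<Rightarrow> 'a set \<Rightarrow> bool" where
  "p_power_order p H \<longleftrightarrow> (\<exists>n. card H = p ^ n)"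

text \<open>The order on subgroups is inclusion, so \<open>GREATEST\<close> picks the largest
  subgroup of the given kind. It exists for finite groups and prime \<open>p\<close>, see
  \<open>O_p'_greatest\<close> and \<open>O_p_greatest\<close> below.\<close>

definition O_p' :: "nat \<Rightarrow> ('a, 'b) monoid_scheme \<Rightarrow> 'a set" where
  "O_p' p K = (GREATEST N. N \<lhd> K \<and> coprime (card N) p)"

definition O_p :: "nat \<Rightarrow> ('a, 'b) monoid_scheme \<Rightarrow> 'a set" where
  "O_p p K = (GREATEST N. N \<lhd> K \<and> p_power_order p N)"

definition p'_reduced :: "nat \<Rightarrow> ('a, 'b) monoid_scheme \<Rightarrow> bool" where
  "p'_reduced p K \<longleftrightarrow> O_p' p K = {\<one>\<^bsub>K\<^esub>}"

definition p_reduced :: "nat \<Rightarrow> ('a, 'b) monoid_scheme \<Rightarrow> bool" where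
  "p_reduced p K \<longleftrightarrow> O_p p K = {\<one>\<^bsub>K\<^esub>}"

lemma (in group) card_normal_set_mult:
  assumes "finite (carrier G)" "H \<lhd> G" "subgroup S G"
  shows "\<exists>d. d dvd card S \<and> card (H <#> S) = card H * d"
proof -
  interpret second_isomorphism_grp H G S
    using assms by (simp add: second_isomorphism_grp_def second_isomorphism_grp_axioms_def)
  let ?S = "G\<lparr>carrier := S\<rparr>" and ?HS = "G\<lparr>carrier := H <#> S\<rparr>"
  have gS: "group ?S" using assms(3) subgroup_imp_group by blast
  have HS: "subgroup (H <#> S) G" by (rule normal_set_mult_subgroup)
  have gHS: "group ?HS" using HS subgroup_imp_group by blast
  have "(?S Mod (H \<inter> S)) \<cong> (?HS Mod H)"
    using normal_intersection_quotient_isom unfolding is_iso_def by (auto simp: Int_commute)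
  hence eq: "card (rcosets\<^bsub>?S\<^esub> (H \<inter> S)) = card (rcosets\<^bsub>?HS\<^esub> H)"
    using iso_same_card by (fastforce simp: FactGroup_def)
  have sub1: "subgroup (H \<inter> S) ?S"
    using normal_subgrp_intersection_normal
    by (simp add: Int_commute normal_imp_subgroup)
  have sub2: "subgroup H ?HS"
    using HS H_contained_in_set_mult is_subgroup by (simp add: subgroup_incl)
  have l1: "card (rcosets\<^bsub>?S\<^esub> (H \<inter> S)) * card (H \<inter> S) = card S"
    using group.lagrange[OF gS sub1] by (simp add: order_def)
  have l2: "card (rcosets\<^bsub>?HS\<^esub> H) * card H = card (H <#> S)"
    using group.lagrange[OF gHS sub2] by (simp add: order_def)
  show ?thesis
    by (rule exI[of _ "card (rcosets\<^bsub>?S\<^esub> (H \<inter> S))"])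
      (metis dvd_triv_left eq l1 l2 mult.commute)
qed

lemma (in group) greatest_normal_exists:
  assumes fin: "finite (carrier G)"
    and one: "P 1" and mult: "\<And>a b. P a \<Longrightarrow> P b \<Longrightarrow> P (a * b)"
    and dvd: "\<And>a b. P b \<Longrightarrow> a dvd b \<Longrightarrow> P a"
  shows "\<exists>N. N \<lhd> G \<and> P (card N) \<and> (\<forall>M. M \<lhd> G \<and> P (card M) \<longrightarrow> M \<subseteq> N)"
proof -
  let ?F = "{N. N \<lhd> G \<and> P (card N)}"
  have sub: "N \<subseteq> carrier G" if "N \<in> ?F" for N
    using that normal_imp_subgroup[of N G] subgroup.subset[of N G] by simp
  have "?F \<subseteq> Pow (carrier G)" using sub by blast
  hence "finite ?F" using fin by (simp add: finite_subset)
  moreover have "{\<one>} \<in> ?F" using one one_is_normal by simp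
  ultimately obtain N where N: "N \<in> ?F" and max: "\<forall>M \<in> ?F. N \<subseteq> M \<longrightarrow> N = M"
    using finite_has_maximal[of ?F] by (metis (lifting) empty_iff)
  have "M \<subseteq> N" if M: "M \<in> ?F" for M
  proof -
    interpret second_isomorphism_grp N G M
      using N M by (simp add: second_isomorphism_grp_def second_isomorphism_grp_axioms_def
          normal_imp_subgroup)
    obtain d where "d dvd card M" "card (N <#> M) = card N * d"
      using card_normal_set_mult[OF fin] N subgrpS by blast
    hence "N <#> M \<in> ?F"
      using N M mult[of "card N" d] dvd[of "card M" d]
        normal_subgroup_set_mult_closed[of N M] by simp
    hence "N = N <#> M" using max H_contained_in_set_mult by simp
    thus ?thesis using S_contained_in_set_mult by simp
  qed
  thus ?thesis using N by blast
qed

lemma O_p'_greatest: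
  assumes "group K" "finite (carrier K)"
  shows "O_p' p K \<lhd> K" "coprime (card (O_p' p K)) p"
    and "M \<lhd> K \<Longrightarrow> coprime (card M) p \<Longrightarrow> M \<subseteq> O_p' p K"
proof -
  let ?P = "\<lambda>N. N \<lhd> K \<and> coprime (card N) p"
  obtain N where N: "?P N" and max: "\<And>M. ?P M \<Longrightarrow> M \<subseteq> N"
  proof -
    have "\<exists>N. N \<lhd> K \<and> coprime (card N) p \<and>
        (\<forall>M. M \<lhd> K \<and> coprime (card M) p \<longrightarrow> M \<subseteq> N)"
    proof (rule group.greatest_normal_exists[OF assms, of "\<lambda>n. coprime n p"])
      show "coprime a p" if "coprime b p" "a dvd b" for a b
        using that coprime_divisors[of a b p p] by simp
    qed simp_all
    thus ?thesis using that by blast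
  qed
  hence "O_p' p K = N"
    unfolding O_p'_def by (intro Greatest_equality) auto
  with N max show "O_p' p K \<lhd> K" "coprime (card (O_p' p K)) p"
    "M \<lhd> K \<Longrightarrow> coprime (card M) p \<Longrightarrow> M \<subseteq> O_p' p K" by auto
qed

lemma O_p_greatest:
  assumes "group K" "finite (carrier K)" "Factorial_Ring.prime p"
  shows "O_p p K \<lhd> K" "p_power_order p (O_p p K)"
    and "M \<lhd> K \<Longrightarrow> p_power_order p M \<Longrightarrow> M \<subseteq> O_p p K"
proof -
  let ?P = "\<lambda>N. N \<lhd> K \<and> p_power_order p N"
  obtain N where N: "?P N" and max: "\<And>M. ?P M \<Longrightarrow> M \<subseteq> N"
  proof -
    have "\<exists>N. N \<lhd> K \<and> (\<exists>n. card N = p ^ n) \<and>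
        (\<forall>M. M \<lhd> K \<and> (\<exists>n. card M = p ^ n) \<longrightarrow> M \<subseteq> N)"
    proof (rule group.greatest_normal_exists[OF assms(1,2), of "\<lambda>c. \<exists>n. c = p ^ n"])
      show "\<exists>n. 1 = p ^ n" by (rule exI[of _ 0]) simp
      show "\<exists>n. a * b = p ^ n" if "\<exists>n. a = p ^ n" "\<exists>n. b = p ^ n" for a b
        using that by (auto simp flip: power_add)
      show "\<exists>n. a = p ^ n" if "\<exists>n. b = p ^ n" "a dvd b" for a b
        using that divides_primepow_nat[OF assms(3)] by auto
    qed
    thus ?thesis using that unfolding p_power_order_def by blast
  qed
  hence "O_p p K = N"
    unfolding O_p_def by (intro Greatest_equality) auto
  with N max show "O_p p K \<lhd> K" "p_power_order p (O_p p K)"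
    "M \<lhd> K \<Longrightarrow> p_power_order p M \<Longrightarrow> M \<subseteq> O_p p K" by auto
qed

definition p_subgroup :: "nat \<Rightarrow> 'a set \<Rightarrow> ('a, 'b) monoid_scheme \<Rightarrow> bool" where
  "p_subgroup p Q G \<longleftrightarrow> subgroup Q G \<and> p_power_order p Q"

definition Sylow_subgroup :: "nat \<Rightarrow> 'a set \<Rightarrow> ('a, 'b) monoid_scheme \<Rightarrow> bool" where
  "Sylow_subgroup p S G \<longleftrightarrow> subgroup S G \<and> card S = p ^ multiplicity p (order G)"

text \<open>The choice of the Sylow subgroup is immaterial, as all of them have the same order
  and meet \<open>O_p' p G\<close> trivially.\<close>

definition p_nilpotent :: "nat \<Rightarrow> ('a, 'b) monoid_scheme \<Rightarrow> bool" where
  "p_nilpotent p G \<longleftrightarrow>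
     (\<exists>S. Sylow_subgroup p S G \<and> carrier G = O_p' p G <#>\<^bsub>G\<^esub> S)"

definition centralizer :: "('a, 'b) monoid_scheme \<Rightarrow> 'a set \<Rightarrow> 'a set" where
  "centralizer G Q = {g \<in> carrier G. \<forall>h \<in> Q. g \<otimes>\<^bsub>G\<^esub> h = h \<otimes>\<^bsub>G\<^esub> g}"

definition center :: "('a, 'b) monoid_scheme \<Rightarrow> 'a set" where
  "center G = centralizer G (carrier G)"

definition p_centric :: "nat \<Rightarrow> 'a set \<Rightarrow> ('a, 'b) monoid_scheme \<Rightarrow> bool" where
  "p_centric p Q G \<longleftrightarrow>
     p_subgroup p Q G \<and>
     Sylow_subgroup p (center (G\<lparr>carrier := Q\<rparr>)) (G\<lparr>carrier := centralizer G Q\<rparr>)"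

definition p_radical :: "nat \<Rightarrow> 'a set \<Rightarrow> ('a, 'b) monoid_scheme \<Rightarrow> bool" where
  "p_radical p Q G \<longleftrightarrow>
     p_subgroup p Q G \<and> p_reduced p (G\<lparr>carrier := normalizer G Q\<rparr> Mod Q)"

end

theory Submission
  imports Defs
begin

text \<open>If \<open>G\<close> is \<open>p\<close>-nilpotent, a reduced section is a \<open>p\<close>-group: \<open>O\<^sub>p\<^sub>'(G)\<close> leaves a normal
  \<open>p'\<close>-subgroup in it, which is trivial. The orders of the elements of a \<open>p\<close>-group form a chain
  under divisibility, so the exponent is attained (\<open>p_nilpotent_imp_phi_nonzero\<close>). Sections of
  \<open>N\<^sub>G(Q)\<close> are sections of \<open>G\<close>, so only one implication is hard: the condition on the centric
  radical \<open>p\<close>-subgroups makes \<open>G\<close> \<open>p\<close>-nilpotent.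

  Suppose that a \<open>p'\<close>-element \<open>x\<close> of \<open>N\<^sub>G(Q)\<close> does not centralize \<open>Q\<close>. Among the sections of
  \<open>N\<^sub>G(Q)\<close> in which some \<open>p'\<close>-element \<open>x\<close> acts nontrivially on a normal \<open>p\<close>-subgroup \<open>P\<close>, one of
  least order has the form \<open>P \<langle>x\<rangle>\<close>, where \<open>P\<close> may be taken to be abelian and every nontrivial
  power of \<open>x\<close> acts on \<open>P\<close> without nontrivial fixed points. Such a group is \<open>p'\<close>-reduced. An
  element whose order is the exponent would have a power of order \<open>p\<close>, which lies in \<open>P\<close> and commutes
  with a nontrivial power of \<open>x\<close>; so \<open>\<phi>\<close> vanishes (\<open>exists_reduced_section_phi_eq_0\<close>). Thus \<open>N\<^sub>G(Q)/C\<^sub>G(Q)\<close> is a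
  \<open>p\<close>-group for every centric radical \<open>Q\<close>.

  A \<open>p\<close>-subgroup \<open>Q\<close> of largest order for which \<open>N\<^sub>G(Q)/C\<^sub>G(Q)\<close> is not a \<open>p\<close>-group would be centric
  and radical, so the quotient is a \<open>p\<close>-group for every \<open>p\<close>-subgroup
  (\<open>frobenius_condition_if_centric_radical\<close>).

  What remains is Frobenius' theorem (\<open>frobenius_normal_complement\<close>). The condition lets a Sylow
  subgroup \<open>S\<close> control its own fusion (\<open>Sylow_controls_fusion\<close>). A homomorphism from \<open>S\<close> onto a
  nontrivial abelian \<open>p\<close>-group therefore takes equal values on elements of \<open>S\<close> that are
  conjugate in \<open>G\<close>, and its transfer (\<open>transfer_exists\<close>) is a nontrivial homomorphism from \<open>G\<close> to a \<open>p\<close>-group. Its kernel contains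
  all \<open>p'\<close>-elements, and induction shows that these form a subgroup.\<close>

section \<open>Conjugates, normalizers and centralizers\<close>

definition conjugate_set :: "('a, 'b) monoid_scheme \<Rightarrow> 'a \<Rightarrow> 'a set \<Rightarrow> 'a set" where
  "conjugate_set G g U = (\<lambda>x. g \<otimes>\<^bsub>G\<^esub> x \<otimes>\<^bsub>G\<^esub> (inv\<^bsub>G\<^esub> g)) ` U"

context group
begin

lemma conjugate_set_subset:
  "g \<in> carrier G \<Longrightarrow> U \<subseteq> carrier G \<Longrightarrow> conjugate_set G g U \<subseteq> carrier G"
  by (auto simp: conjugate_set_def)

lemma conjugate_set_mult:
  assumes "g \<in> carrier G" "h \<in> carrier G" "U \<subseteq> carrier G"
  shows "conjugate_set G (g \<otimes> h) U = conjugate_set G g (conjugate_set G h U)"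
  unfolding conjugate_set_def image_image using assms
  by (intro image_cong refl) (auto simp: m_assoc inv_mult_group subset_iff)

lemma conjugate_set_one: "U \<subseteq> carrier G \<Longrightarrow> conjugate_set G \<one> U = U"
  by (force simp: conjugate_set_def subset_iff)

lemma conjugate_set_mono: "U \<subseteq> W \<Longrightarrow> conjugate_set G g U \<subseteq> conjugate_set G g W"
  by (auto simp: conjugate_set_def)

lemma inj_on_conj: "g \<in> carrier G \<Longrightarrow> inj_on (\<lambda>x. g \<otimes> x \<otimes> inv g) (carrier G)"
  by (auto simp: inj_on_def)

lemma card_conjugate_set:
  assumes "g \<in> carrier G" "U \<subseteq> carrier G"
  shows "card (conjugate_set G g U) = card U"
  unfolding conjugate_set_def using assms inj_on_conj by (metis card_image inj_on_subset)

lemma conj_mult: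
  assumes "g \<in> carrier G" "x \<in> carrier G" "y \<in> carrier G"
  shows "(g \<otimes> x \<otimes> inv g) \<otimes> (g \<otimes> y \<otimes> inv g) = g \<otimes> (x \<otimes> y) \<otimes> inv g"
  using assms by (metis inv_closed inv_solve_right m_assoc m_closed)

lemma conj_inv:
  assumes "g \<in> carrier G" "x \<in> carrier G"
  shows "inv (g \<otimes> x \<otimes> inv g) = g \<otimes> inv x \<otimes> inv g"
  using assms by (simp add: inv_mult_group m_assoc)

lemma subgroup_conjugate_set:
  assumes "g \<in> carrier G" "subgroup H G"
  shows "subgroup (conjugate_set G g H) G"
proof (rule subgroupI)
  have H: "H \<subseteq> carrier G" using assms(2) by (rule subgroup.subset)
  show "conjugate_set G g H \<subseteq> carrier G" using assms(1) H by (rule conjugate_set_subset)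
  show "conjugate_set G g H \<noteq> {}"
    using assms(2) by (auto simp: conjugate_set_def dest: subgroup.one_closed)
  fix a b assume "a \<in> conjugate_set G g H" "b \<in> conjugate_set G g H"
  then obtain x y where "x \<in> H" "y \<in> H" "a = g \<otimes> x \<otimes> inv g" "b = g \<otimes> y \<otimes> inv g"
    by (auto simp: conjugate_set_def)
  thus "inv a \<in> conjugate_set G g H" "a \<otimes> b \<in> conjugate_set G g H"
    using assms H unfolding conjugate_set_def
    by (auto simp: conj_mult conj_inv subset_iff subgroup.m_closed subgroup.m_inv_closed)
qed

lemma conjugate_set_eqI:
  assumes "finite (carrier G)" "g \<in> carrier G" "U \<subseteq> carrier G" "\<And>x. x \<in> U \<Longrightarrow> g \<otimes> x \<otimes> inv g \<in> U"
  shows "conjugate_set G g U = U"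
  using assms by (intro card_subset_eq) (auto simp: conjugate_set_def intro: finite_subset
      simp: card_conjugate_set[unfolded conjugate_set_def])

lemma conjugate_set_eq_cosets: "(g <# U) #> inv g = conjugate_set G g U"
  by (auto simp: conjugate_set_def l_coset_def r_coset_def)

lemma mem_normalizer_iff:
  assumes "U \<subseteq> carrier G"
  shows "g \<in> normalizer G U \<longleftrightarrow> g \<in> carrier G \<and> conjugate_set G g U = U"
  using assms by (simp add: normalizer_def stabilizer_def conjugate_set_eq_cosets)

lemma subgroup_normalizer: "subgroup Q G \<Longrightarrow> subgroup (normalizer G Q) G"
  by (simp add: normalizer_imp_subgroup subgroup.subset)

lemma subgroup_le_normalizer: "subgroup Q G \<Longrightarrow> Q \<subseteq> normalizer G Q"
  using normal_imp_subgroup[OF subgroup_in_normalizer, THEN subgroup.subset] by simp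

lemma subgroup_centralizer:
  assumes "U \<subseteq> carrier G" shows "subgroup (centralizer G U) G"
proof (rule subgroupI)
  show "centralizer G U \<subseteq> carrier G" by (auto simp: centralizer_def)
  show "centralizer G U \<noteq> {}" using assms by (auto simp: centralizer_def intro!: exI[of _ \<one>])
next
  fix a assume a: "a \<in> centralizer G U"
  have "inv a \<otimes> h = h \<otimes> inv a" if "h \<in> U" for h
  proof -
    have "h \<in> carrier G" "a \<in> carrier G" "a \<otimes> h = h \<otimes> a"
      using a that assms by (auto simp: centralizer_def)
    thus ?thesis by (metis inv_closed inv_solve_left inv_solve_right m_assoc m_closed)
  qed
  thus "inv a \<in> centralizer G U" using a by (auto simp: centralizer_def)
next
  fix a b assume "a \<in> centralizer G U" "b \<in> centralizer G U"
  moreover have "(a \<otimes> b) \<otimes> h = h \<otimes> (a \<otimes> b)"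
    if "a \<otimes> h = h \<otimes> a" "b \<otimes> h = h \<otimes> b" "a \<in> carrier G" "b \<in> carrier G" "h \<in> carrier G" for h
    using that by (metis m_assoc)
  ultimately show "a \<otimes> b \<in> centralizer G U" using assms by (auto simp: centralizer_def)
qed

lemma centralizer_mono: "U \<subseteq> W \<Longrightarrow> centralizer G W \<subseteq> centralizer G U"
  by (auto simp: centralizer_def)

lemma conj_eq_self_iff:
  assumes "g \<in> carrier G" "x \<in> carrier G"
  shows "g \<otimes> x \<otimes> inv g = x \<longleftrightarrow> g \<otimes> x = x \<otimes> g"
  using assms by (metis inv_solve_right m_closed)

lemma centralizer_le_normalizer:
  assumes "U \<subseteq> carrier G" shows "centralizer G U \<subseteq> normalizer G U"
proof
  fix g assume g: "g \<in> centralizer G U"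
  hence gG: "g \<in> carrier G" by (simp add: centralizer_def)
  have "conjugate_set G g U = (\<lambda>x. x) ` U"
    unfolding conjugate_set_def using g assms
    by (intro image_cong refl) (auto simp: centralizer_def subset_iff m_assoc)
  thus "g \<in> normalizer G U" using gG assms by (simp add: mem_normalizer_iff)
qed

text \<open>The centralizer of \<open>U\<close> is the kernel of the action of \<open>N\<^sub>G(U)\<close> on \<open>U\<close>.\<close>

lemma centralizer_conj_closed:
  assumes U: "U \<subseteq> carrier G" and c: "c \<in> centralizer G U" and n: "n \<in> normalizer G U"
  shows "n \<otimes> c \<otimes> inv n \<in> centralizer G U"
proof -
  have nG: "n \<in> carrier G" and nX: "conjugate_set G n U = U"
    using n U by (auto simp: mem_normalizer_iff)
  have cG: "c \<in> carrier G" using c by (simp add: centralizer_def)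
  have "(n \<otimes> c \<otimes> inv n) \<otimes> h = h \<otimes> (n \<otimes> c \<otimes> inv n)" if h: "h \<in> U" for h
  proof -
    obtain x where x: "x \<in> U" "h = n \<otimes> x \<otimes> inv n"
      using h nX by (metis (no_types, lifting) conjugate_set_def imageE)
    have "c \<otimes> x = x \<otimes> c" using c x by (simp add: centralizer_def)
    thus ?thesis using x nG cG U by (auto simp: conj_mult subset_iff)
  qed
  thus ?thesis using nG cG by (simp add: centralizer_def)
qed

lemma centralizer_normal_in_normalizer:
  assumes "subgroup Q G"
  shows "centralizer G Q \<lhd> G\<lparr>carrier := normalizer G Q\<rparr>"
proof -
  let ?N = "normalizer G Q" and ?C = "centralizer G Q"
  have Q: "Q \<subseteq> carrier G" using assms by (rule subgroup.subset)
  have N: "subgroup ?N G" using assms by (rule subgroup_normalizer)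
  interpret N: group "G\<lparr>carrier := ?N\<rparr>" using N by (rule subgroup_imp_group)
  have "subgroup ?C (G\<lparr>carrier := ?N\<rparr>)"
    using subgroup_centralizer[OF Q] N centralizer_le_normalizer[OF Q] by (rule subgroup_incl)
  thus ?thesis using N centralizer_conj_closed[OF Q]
    by (intro N.normal_invI) auto
qed

end

section \<open>Actions of \<open>p\<close>-groups\<close>

lemma group_actionI:
  assumes "group K"
    and closed: "\<And>g x. g \<in> carrier K \<Longrightarrow> x \<in> E \<Longrightarrow> act g x \<in> E"
    and one: "\<And>x. x \<in> E \<Longrightarrow> act \<one>\<^bsub>K\<^esub> x = x"
    and mult: "\<And>g h x. g \<in> carrier K \<Longrightarrow> h \<in> carrier K \<Longrightarrow> x \<in> E \<Longrightarrow>
      act (g \<otimes>\<^bsub>K\<^esub> h) x = act g (act h x)"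
  shows "group_action K E (\<lambda>g. \<lambda>x\<in>E. act g x)"
proof -
  interpret group K by fact
  have inv: "act (inv\<^bsub>K\<^esub> g) (act g x) = x" if "g \<in> carrier K" "x \<in> E" for g x
    using that mult[of "inv\<^bsub>K\<^esub> g" g x] one by simp
  have bij: "bij_betw (act g) E E" if "g \<in> carrier K" for g
    by (rule bij_betw_byWitness[of _ "act (inv\<^bsub>K\<^esub> g)"])
       (use that inv[of g] inv[of "inv\<^bsub>K\<^esub> g"] closed in auto)
  have Bij: "restrict (act g) E \<in> Bij E" if "g \<in> carrier K" for g
    using bij[OF that] by (simp add: Bij_def)
  have "(\<lambda>g. restrict (act g) E) \<in> hom K (BijGroup E)"
    using Bij closed mult by (auto simp: hom_def BijGroup_def compose_def fun_eq_iff restrict_def)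
  thus ?thesis
    by (simp add: group_action_def group_hom_def group_hom_axioms_def group_BijGroup)
qed

text \<open>The orbits have lengths dividing \<open>p\<^sup>n\<close>, so those that are not fixed points do not matter
  modulo \<open>p\<close>.\<close>

lemma prime_dvd_card_iff_fixed_points:
  fixes p :: nat
  assumes act: "group_action K E \<phi>" and p: "Factorial_Ring.prime p"
    and K: "order K = p ^ n" and E: "finite E"
  shows "p dvd card E \<longleftrightarrow> p dvd card {x \<in> E. \<forall>g \<in> carrier K. \<phi> g x = x}"
proof -
  interpret group_action K E \<phi> by fact
  interpret K: group K using group_hom by (simp add: group_hom_def)
  let ?F = "{x \<in> E. \<forall>g \<in> carrier K. \<phi> g x = x}" and ?O = "orbits K E \<phi>"
  have fixed: "orbit K \<phi> x = {x}" if "x \<in> ?F" for x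
    using that by (force simp: orbit_def)
  have card_eq: "card E = (\<Sum>orb\<in>?O. card orb)"
    using disjoint_sum[OF E, of "\<lambda>_. 1::nat"] by simp
  have finO: "finite ?O" using E by (simp add: orbits_def)
  have sub: "(\<lambda>x. {x}) ` ?F \<subseteq> ?O"
    using fixed by (fastforce simp: orbits_def)
  have "card E = (\<Sum>orb\<in>(\<lambda>x. {x}) ` ?F. card orb) + (\<Sum>orb\<in>?O - (\<lambda>x. {x}) ` ?F. card orb)"
    using card_eq sum.subset_diff[OF sub finO, of card] by simp
  also have "(\<Sum>orb\<in>(\<lambda>x. {x}) ` ?F. card orb) = card ?F"
    by (subst sum.reindex) (auto simp: inj_on_def)
  finally have eq: "card E = card ?F + (\<Sum>orb\<in>?O - (\<lambda>x. {x}) ` ?F. card orb)" .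
  have "p dvd card orb" if orb: "orb \<in> ?O - (\<lambda>x. {x}) ` ?F" for orb
  proof -
    obtain x where x: "x \<in> E" "orb = orbit K \<phi> x" using orb by (auto simp: orbits_def)
    have "card orb dvd p ^ n"
      using orbit_stabilizer_theorem[OF x(1)] x(2) K by (metis dvd_triv_left)
    then obtain i where i: "card orb = p ^ i" using divides_primepow_nat[OF p] by auto
    have "i \<noteq> 0"
    proof
      assume "i = 0"
      hence "card orb = 1" using i by simp
      moreover have "x \<in> orb" using x orbit_refl by simp
      ultimately have single: "orb = {x}" by (metis card_1_singletonE singletonD)
      hence "\<phi> g x = x" if "g \<in> carrier K" for g
        using that x(2) by (auto simp: orbit_def)
      thus False using orb single x(1) by auto
    qed
    thus ?thesis using i by (simp add: dvd_power)
  qed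
  hence "p dvd (\<Sum>orb\<in>?O - (\<lambda>x. {x}) ` ?F. card orb)" by (intro dvd_sum) auto
  thus ?thesis using eq by (simp add: dvd_add_left_iff)
qed


context group
begin

text \<open>Inverting the group element turns right multiplication of cosets into a left action. The
  coset \<open>H x\<close> is fixed by \<open>Q\<close> when \<open>x Q x\<^sup>-\<^sup>1 \<subseteq> H\<close>; fixed cosets thus produce conjugating and
  normalizing elements.\<close>

lemma group_action_on_rcosets:
  assumes H: "subgroup H G" and Q: "subgroup Q G"
  shows "group_action (G\<lparr>carrier := Q\<rparr>) (rcosets H) (\<lambda>g. \<lambda>C\<in>rcosets H. C #> inv g)"
proof (rule group_actionI)
  have Hs: "H \<subseteq> carrier G" and Qs: "Q \<subseteq> carrier G" using assms by (auto dest: subgroup.subset)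
  show "group (G\<lparr>carrier := Q\<rparr>)" using Q by (rule subgroup_imp_group)
  have C: "C \<subseteq> carrier G" if "C \<in> rcosets H" for C
    using that H subgroup.rcosets_carrier by blast
  show "C #> inv g \<in> rcosets H" if "g \<in> carrier (G\<lparr>carrier := Q\<rparr>)" "C \<in> rcosets H" for g C
    using that Hs Qs by (auto simp: RCOSETS_def coset_mult_assoc subset_iff)
  show "C #> inv \<one>\<^bsub>G\<lparr>carrier := Q\<rparr>\<^esub> = C" if "C \<in> rcosets H" for C
    using C[OF that] by simp
  show "C #> inv (g \<otimes>\<^bsub>G\<lparr>carrier := Q\<rparr>\<^esub> h) = C #> inv h #> inv g"
    if "g \<in> carrier (G\<lparr>carrier := Q\<rparr>)" "h \<in> carrier (G\<lparr>carrier := Q\<rparr>)" "C \<in> rcosets H" for g h C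
    using that C[OF that(3)] Qs by (auto simp: coset_mult_assoc inv_mult_group subset_iff)
qed

lemma rcoset_fixed_iff:
  assumes H: "subgroup H G" and x: "x \<in> carrier G" and g: "g \<in> carrier G"
  shows "H #> x #> inv g = H #> x \<longleftrightarrow> x \<otimes> g \<otimes> inv x \<in> H"
proof -
  have Hs: "H \<subseteq> carrier G" using H by (rule subgroup.subset)
  have "H #> x #> inv g = H #> x \<longleftrightarrow> H #> (x \<otimes> inv g) = H #> x"
    using x g Hs by (simp add: coset_mult_assoc)
  also have "\<dots> \<longleftrightarrow> x \<in> H #> (x \<otimes> inv g)"
    using x g H by (metis inv_closed m_closed rcos_self repr_independence)
  also have "\<dots> \<longleftrightarrow> x \<otimes> inv (x \<otimes> inv g) \<in> H"
    using x g H by (metis inv_closed m_closed subgroup.rcos_module[OF H is_group])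
  also have "x \<otimes> inv (x \<otimes> inv g) = x \<otimes> g \<otimes> inv x"
    using x g by (simp add: inv_mult_group m_assoc)
  finally show ?thesis .
qed

end

locale finite_group_prime = group G for G (structure) +
  fixes p :: nat
  assumes finite_carrier [simp]: "finite (carrier G)"
    and prime_p: "Factorial_Ring.prime p"
begin

lemma finite_subgroup: "subgroup H G \<Longrightarrow> finite H"
  using finite_carrier finite_subset subgroup.subset by blast

lemma card_subgroup_pos: "subgroup H G \<Longrightarrow> card H > 0"
  using finite_subgroup card_gt_0_iff subgroup.one_closed by blast

lemma order_pos: "order G > 0"
  by (simp add: order_gt_0_iff_finite)

lemma restrict_finite_group_prime:
  "subgroup H G \<Longrightarrow> finite_group_prime (G\<lparr>carrier := H\<rparr>) p"
  using subgroup_imp_group finite_subgroup prime_p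
  by (simp add: finite_group_prime_def finite_group_prime_axioms_def)

lemma quotient_finite_group_prime:
  assumes "N \<lhd> G" shows "finite_group_prime (G Mod N) p"
  using assms normal.factorgroup_is_group[OF assms] prime_p
  by (simp add: finite_group_prime_def finite_group_prime_axioms_def carrier_FactGroup)

lemma card_subgroup_dvd: "subgroup H G \<Longrightarrow> card H dvd order G"
  by (metis dvd_triv_right lagrange)

lemma card_subgroup_dvd_subgroup:
  assumes "subgroup H G" "subgroup K G" "H \<subseteq> K"
  shows "card H dvd card K"
proof -
  interpret K: group "G\<lparr>carrier := K\<rparr>" using assms(2) by (rule subgroup_imp_group)
  have "card (rcosets\<^bsub>G\<lparr>carrier := K\<rparr>\<^esub> H) * card H = card K"
    using K.lagrange[OF subgroup_incl[OF assms]] by (simp add: order_def)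
  thus ?thesis by (metis dvd_triv_right)
qed

lemma p_power_order_dvd: "p_power_order p K \<Longrightarrow> card H dvd card K \<Longrightarrow> p_power_order p H"
  using divides_primepow_nat[OF prime_p] by (auto simp: p_power_order_def)

lemma p_subgroup_mono:
  assumes "p_subgroup p K G" "subgroup H G" "H \<subseteq> K"
  shows "p_subgroup p H G"
  using assms card_subgroup_dvd_subgroup[of H K] p_power_order_dvd[of K H] by (simp add: p_subgroup_def)

lemma prime_dvd_index_of_proper_subgroup:
  assumes "p_power_order p P" "subgroup H G" "subgroup P G" "H \<subset> P"
  shows "p dvd card (rcosets\<^bsub>G\<lparr>carrier := P\<rparr>\<^esub> H)"
proof -
  interpret P: finite_group_prime "G\<lparr>carrier := P\<rparr>" p
    using assms(3) by (rule restrict_finite_group_prime)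
  have "subgroup H (G\<lparr>carrier := P\<rparr>)" using assms by (intro subgroup_incl) auto
  hence lag: "card (rcosets\<^bsub>G\<lparr>carrier := P\<rparr>\<^esub> H) * card H = card P"
    using P.lagrange by (simp add: order_def)
  have "card H < card P" using assms finite_subgroup by (simp add: psubset_card_mono)
  obtain n where "card P = p ^ n" using assms(1) by (auto simp: p_power_order_def)
  hence "card (rcosets\<^bsub>G\<lparr>carrier := P\<rparr>\<^esub> H) dvd p ^ n" using lag by (metis dvd_triv_left)
  then obtain i where i: "card (rcosets\<^bsub>G\<lparr>carrier := P\<rparr>\<^esub> H) = p ^ i"
    using divides_primepow_nat[OF prime_p] by auto
  have "i \<noteq> 0"
  proof
    assume "i = 0"
    thus False using i lag \<open>card H < card P\<close> by simp
  qed
  thus ?thesis using i by (simp add: dvd_power)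
qed

subsection \<open>Sylow subgroups\<close>

lemma not_dvd_index_Sylow:
  assumes "Sylow_subgroup p S G" shows "\<not> p dvd card (rcosets S)"
proof
  assume "p dvd card (rcosets S)"
  moreover have "card (rcosets S) * card S = order G"
    using assms lagrange[of S] unfolding Sylow_subgroup_def by blast
  ultimately have "p * card S dvd order G" by (metis dvd_refl mult_dvd_mono)
  hence "p ^ Suc (multiplicity p (order G)) dvd order G"
    using assms by (simp add: Sylow_subgroup_def)
  hence "Suc (multiplicity p (order G)) \<le> multiplicity p (order G)"
    using order_pos prime_p by (intro multiplicity_geI) auto
  thus False by simp
qed

lemma Sylow_p_subgroup: "Sylow_subgroup p S G \<Longrightarrow> p_subgroup p S G"
  by (auto simp: Sylow_subgroup_def p_subgroup_def p_power_order_def)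

lemma Sylow_exists: "\<exists>S. Sylow_subgroup p S G"
proof -
  have "p ^ multiplicity p (order G) dvd order G" by (rule multiplicity_dvd)
  then obtain m where "order G = p ^ multiplicity p (order G) * m" by (auto simp: dvd_def)
  from sylow_thm[OF prime_p is_group this finite_carrier] show ?thesis
    by (auto simp: Sylow_subgroup_def)
qed

text \<open>The number of cosets of \<open>S\<close> is prime to \<open>p\<close>, so \<open>Q\<close> fixes one of them.\<close>

lemma p_subgroup_le_conjugate_Sylow:
  assumes Q: "p_subgroup p Q G" and S: "Sylow_subgroup p S G"
  shows "\<exists>g \<in> carrier G. Q \<subseteq> conjugate_set G g S"
proof -
  have QG: "subgroup Q G" and SG: "subgroup S G"
    using Q S by (auto simp: p_subgroup_def Sylow_subgroup_def)
  let ?K = "G\<lparr>carrier := Q\<rparr>"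
  obtain n where n: "card Q = p ^ n" using Q by (auto simp: p_subgroup_def p_power_order_def)
  have fin: "finite (rcosets S)" by (simp add: RCOSETS_def)
  let ?F = "{C \<in> rcosets S. \<forall>g \<in> carrier ?K. (\<lambda>C\<in>rcosets S. C #> inv g) C = C}"
  have "p dvd card (rcosets S) \<longleftrightarrow> p dvd card ?F"
    using prime_dvd_card_iff_fixed_points[OF group_action_on_rcosets[OF SG QG] prime_p, of n] n fin
    by (simp add: order_def)
  hence "card ?F \<noteq> 0" using not_dvd_index_Sylow[OF S] by (metis dvd_0_right)
  hence "?F \<noteq> {}" by (metis card.empty)
  then obtain C where C: "C \<in> rcosets S" "\<And>g. g \<in> Q \<Longrightarrow> C #> inv g = C" by auto
  then obtain x where x: "x \<in> carrier G" "C = S #> x" by (auto simp: RCOSETS_def)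
  have mem: "x \<otimes> g \<otimes> inv x \<in> S" if "g \<in> Q" for g
    using C(2)[OF that] x(2) rcoset_fixed_iff[OF SG x(1) subgroup.mem_carrier[OF QG that]] by simp
  have "g \<in> conjugate_set G (inv x) S" if g: "g \<in> Q" for g
  proof -
    have gG: "g \<in> carrier G" using QG g by (rule subgroup.mem_carrier)
    have "g = inv x \<otimes> (x \<otimes> g \<otimes> inv x) \<otimes> inv (inv x)"
      using x(1) gG conjugation_is_surj[of "inv x" g] by simp
    thus ?thesis using mem[OF g] unfolding conjugate_set_def by blast
  qed
  thus ?thesis using x(1) by (intro bexI[of _ "inv x"]) auto
qed

lemma Sylow_conjugate:
  assumes S: "Sylow_subgroup p S G" and T: "Sylow_subgroup p T G"
  shows "\<exists>g \<in> carrier G. T = conjugate_set G g S"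
proof -
  obtain g where g: "g \<in> carrier G" "T \<subseteq> conjugate_set G g S"
    using p_subgroup_le_conjugate_Sylow[OF Sylow_p_subgroup[OF T] S] by blast
  have Ss: "S \<subseteq> carrier G" using S by (simp add: Sylow_subgroup_def subgroup.subset)
  have "card T = card (conjugate_set G g S)"
    using S T g(1) Ss by (simp add: card_conjugate_set Sylow_subgroup_def)
  moreover have "finite (conjugate_set G g S)"
    using finite_subset[OF conjugate_set_subset[OF g(1) Ss]] by simp
  ultimately have "T = conjugate_set G g S" using g(2) by (simp add: card_subset_eq)
  thus ?thesis using g(1) by blast
qed

lemma Sylow_conjugate_set:
  assumes "Sylow_subgroup p S G" "g \<in> carrier G"
  shows "Sylow_subgroup p (conjugate_set G g S) G"
  using assms by (simp add: Sylow_subgroup_def subgroup_conjugate_set card_conjugate_set subgroup.subset)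

lemma p_subgroup_le_Sylow:
  assumes "p_subgroup p Q G"
  shows "\<exists>S. Sylow_subgroup p S G \<and> Q \<subseteq> S"
proof -
  obtain S where "Sylow_subgroup p S G" using Sylow_exists by blast
  moreover from p_subgroup_le_conjugate_Sylow[OF assms this]
  obtain g where "g \<in> carrier G" "Q \<subseteq> conjugate_set G g S" by blast
  ultimately show ?thesis using Sylow_conjugate_set by blast
qed

text \<open>Normalizers grow in \<open>p\<close>-groups: \<open>D\<close> acts on the cosets of \<open>D\<close> in \<open>P\<close>, whose number is
  divisible by \<open>p\<close>, and it fixes the coset \<open>D\<close>; hence it fixes a further one.\<close>

lemma normalizer_grows:
  assumes P: "p_subgroup p P G" and D: "subgroup D G" and DP: "D \<subset> P"
  shows "\<exists>g \<in> P - D. conjugate_set G g D = D"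
proof -
  have PG: "subgroup P G" using P by (simp add: p_subgroup_def)
  let ?P = "G\<lparr>carrier := P\<rparr>"
  interpret P: finite_group_prime ?P p using PG by (rule restrict_finite_group_prime)
  have DP': "subgroup D ?P" using D PG DP by (intro subgroup_incl) auto
  obtain n where n: "card D = p ^ n"
    using p_subgroup_mono[OF P D] DP by (auto simp: p_subgroup_def p_power_order_def)
  have act: "group_action (G\<lparr>carrier := D\<rparr>) (rcosets\<^bsub>?P\<^esub> D) (\<lambda>g. \<lambda>C\<in>rcosets\<^bsub>?P\<^esub> D. C #>\<^bsub>?P\<^esub> inv\<^bsub>?P\<^esub> g)"
    using P.group_action_on_rcosets[OF DP' DP'] by simp
  have fin: "finite (rcosets\<^bsub>?P\<^esub> D)" using PG finite_subgroup by (simp add: RCOSETS_def)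
  let ?F = "{C \<in> rcosets\<^bsub>?P\<^esub> D. \<forall>g \<in> D. C #>\<^bsub>?P\<^esub> inv\<^bsub>?P\<^esub> g = C}"
  have eq: "?F = {C \<in> rcosets\<^bsub>?P\<^esub> D. \<forall>g \<in> carrier (G\<lparr>carrier := D\<rparr>).
      (\<lambda>C\<in>rcosets\<^bsub>?P\<^esub> D. C #>\<^bsub>?P\<^esub> inv\<^bsub>?P\<^esub> g) C = C}" by auto
  have "p dvd card ?F"
    unfolding eq
    using prime_dvd_card_iff_fixed_points[OF act prime_p _ fin, of n] n
      prime_dvd_index_of_proper_subgroup[OF _ D PG DP] P by (simp add: order_def p_subgroup_def)
  have one_fixed: "D \<in> ?F"
  proof -
    have "D = D #>\<^bsub>?P\<^esub> \<one>" using D subgroup.subset by fastforce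
    hence "D \<in> rcosets\<^bsub>?P\<^esub> D" using PG by (auto simp: RCOSETS_def subgroup.one_closed)
    moreover have "D #>\<^bsub>?P\<^esub> inv\<^bsub>?P\<^esub> g = D" if "g \<in> D" for g
      using that D DP PG coset_join2[of "inv g" D] subgroup.m_inv_closed[OF D that]
      by (simp add: subgroup.mem_carrier[OF D] m_inv_consistent[OF PG] subset_iff psubset_eq)
    ultimately show ?thesis by simp
  qed
  have "?F \<noteq> {D}"
  proof
    assume "?F = {D}"
    hence "p dvd 1" using \<open>p dvd card ?F\<close> by simp
    thus False using prime_p by (metis not_prime_unit)
  qed
  then obtain C where "C \<in> ?F" and CD: "C \<noteq> D" using one_fixed by blast
  hence C: "C \<in> rcosets\<^bsub>?P\<^esub> D" "\<And>g. g \<in> D \<Longrightarrow> C #>\<^bsub>?P\<^esub> inv\<^bsub>?P\<^esub> g = C"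
    by simp_all
  from C(1) obtain x where x: "x \<in> P" "C = D #>\<^bsub>?P\<^esub> x" by (auto simp: RCOSETS_def)
  have xG: "x \<in> carrier G" using PG x(1) by (rule subgroup.mem_carrier)
  have "x \<notin> D" using x CD D coset_join2[OF xG D] by auto
  moreover have "x \<otimes> g \<otimes> inv x \<in> D" if g: "g \<in> D" for g
    using P.rcoset_fixed_iff[OF DP', of x g] C(2)[OF g] x g DP m_inv_consistent[OF PG x(1)] by auto
  ultimately show ?thesis using x(1) xG D
    by (intro bexI[of _ x] conjugate_set_eqI) (auto dest: subgroup.subset)
qed

text \<open>The class equation: the centre consists of the fixed points of conjugation, and their number
  is divisible by \<open>p\<close>.\<close>

lemma center_nontrivial:
  assumes "p_power_order p (carrier G)" "carrier G \<noteq> {\<one>}"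
  shows "center G \<noteq> {\<one>}"
proof
  assume triv: "center G = {\<one>}"
  obtain n where n: "order G = p ^ n" using assms(1) by (auto simp: p_power_order_def order_def)
  have "n \<noteq> 0" using assms(2) n order_one_triv_iff by auto
  hence "p dvd card (carrier G)" using n by (simp add: order_def dvd_power)
  hence "p dvd card {x \<in> carrier G. \<forall>g \<in> carrier G. (\<lambda>h\<in>carrier G. g \<otimes> h \<otimes> inv g) x = x}"
    using prime_dvd_card_iff_fixed_points[OF action_by_conjugation prime_p n finite_carrier] by simp
  also have "{x \<in> carrier G. \<forall>g \<in> carrier G. (\<lambda>h\<in>carrier G. g \<otimes> h \<otimes> inv g) x = x} = center G"
    by (auto simp: center_def centralizer_def conj_eq_self_iff)
  finally show False using triv prime_p by (simp add: not_prime_unit)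
qed

end

section \<open>Elements of order prime to \<open>p\<close>\<close>

lemma (in group) ord_restrict: "group.ord (G\<lparr>carrier := H\<rparr>) x = ord x" if "subgroup H G"
  using subgroup_imp_group[OF that] by (simp add: group.ord_def ord_def flip: nat_pow_consistent)

lemma (in group) conjugate_set_restrict:
  assumes "subgroup H G" "g \<in> H"
  shows "conjugate_set (G\<lparr>carrier := H\<rparr>) g U = conjugate_set G g U"
  using assms by (simp add: conjugate_set_def)

context finite_group_prime
begin

text \<open>The exponent is the \<open>p\<close>-part of the order of \<open>x\<close>.\<close>

lemma p'_element_pow:
  assumes "x \<in> carrier G"
  shows "\<exists>a. coprime (ord (x [^] (p ^ a))) p"
proof -
  have "ord x \<noteq> 0" using assms ord_ge_1[OF finite_carrier assms] by simp
  then obtain b where b: "ord x = p ^ multiplicity p (ord x) * b" "\<not> p dvd b"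
    using multiplicity_decompose'[of "ord x" p] prime_p by (metis not_prime_unit)
  have "ord (x [^] (p ^ multiplicity p (ord x))) = ord x div p ^ multiplicity p (ord x)"
    using assms prime_p by (intro ord_pow) (auto simp: multiplicity_dvd)
  also have "\<dots> = b" using b(1) prime_p
    by (metis nonzero_mult_div_cancel_left not_prime_0 power_not_zero)
  finally show ?thesis using b(2) prime_p by (metis coprime_commute prime_imp_coprime)
qed

text \<open>As \<open>p\<^sup>a\<close> is invertible modulo the order of \<open>x\<close>, the element \<open>x\<close> is a power of \<open>x [^] p\<^sup>a\<close>.\<close>

lemma p'_element_mem_of_pow:
  assumes x: "x \<in> carrier G" "coprime (ord x) p" and C: "subgroup C G" and mem: "x [^] (p ^ a) \<in> C"
  shows "x \<in> C"
proof -
  have "coprime (p ^ a) (ord x)" using x(2) by (simp add: coprime_commute)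
  moreover have "p ^ a \<noteq> 0" using prime_p by auto
  ultimately obtain u v where uv: "p ^ a * u = ord x * v + 1"
    using bezout_nat[of "p ^ a" "ord x"] by (metis coprime_imp_gcd_eq_1)
  have "(x [^] (p ^ a)) [^] u = x [^] (ord x * v) \<otimes> x [^] (1::nat)"
    using x(1) uv by (simp add: nat_pow_pow nat_pow_mult)
  also have "x [^] (ord x * v) = \<one>" using x(1) pow_eq_id by simp
  finally have "(x [^] (p ^ a)) [^] u = x" using x(1) by simp
  moreover have "(x [^] (p ^ a)) [^] u \<in> C"
  proof -
    interpret C: group "G\<lparr>carrier := C\<rparr>" using C by (rule subgroup_imp_group)
    show ?thesis using C.nat_pow_closed[of "x [^] (p ^ a)" u] mem
      by (simp flip: nat_pow_consistent)
  qed
  ultimately show ?thesis by simp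
qed

lemma ord_p_power:
  assumes "p_subgroup p P G" "x \<in> P"
  shows "\<exists>k. ord x = p ^ k"
proof -
  have PG: "subgroup P G" using assms by (simp add: p_subgroup_def)
  interpret P: group "G\<lparr>carrier := P\<rparr>" using PG by (rule subgroup_imp_group)
  have "ord x dvd card P"
    using P.ord_dvd_group_order[of x] assms(2) PG by (simp add: ord_restrict order_def)
  thus ?thesis using assms(1) divides_primepow_nat[OF prime_p]
    by (auto simp: p_subgroup_def p_power_order_def)
qed

lemma Sylow_in_subgroup:
  assumes S: "Sylow_subgroup p S G" and H: "subgroup H G" "S \<subseteq> H"
  shows "Sylow_subgroup p S (G\<lparr>carrier := H\<rparr>)"
proof -
  have SG: "subgroup S G" and cS: "card S = p ^ multiplicity p (order G)"
    using S by (auto simp: Sylow_subgroup_def)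
  have "multiplicity p (card H) = multiplicity p (order G)"
  proof (rule antisym)
    show "multiplicity p (card H) \<le> multiplicity p (order G)"
      using card_subgroup_dvd[OF H(1)] order_pos by (intro dvd_imp_multiplicity_le) auto
    show "multiplicity p (order G) \<le> multiplicity p (card H)"
      using card_subgroup_dvd_subgroup[OF SG H] cS card_subgroup_pos[OF H(1)] prime_p
      by (intro multiplicity_geI) auto
  qed
  thus ?thesis using subgroup_incl[OF SG H] cS by (simp add: Sylow_subgroup_def order_def)
qed

text \<open>The index of \<open>C T\<close> is prime to \<open>p\<close> because of \<open>T\<close>, and prime to every other prime \<open>q\<close>
  because \<open>C\<close> contains the Sylow \<open>q\<close>-subgroups.\<close>

lemma normal_mult_Sylow_eq_carrier:
  assumes C: "C \<lhd> G" and p': "\<And>x. x \<in> carrier G \<Longrightarrow> coprime (ord x) p \<Longrightarrow> x \<in> C"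
    and T: "Sylow_subgroup p T G"
  shows "carrier G = C <#> T"
proof -
  have CG: "subgroup C G" using C by (rule normal_imp_subgroup)
  have TG: "subgroup T G" and cT: "card T = p ^ multiplicity p (order G)"
    using T by (auto simp: Sylow_subgroup_def)
  interpret second_isomorphism_grp C G T
    using C TG by (simp add: second_isomorphism_grp_def second_isomorphism_grp_axioms_def)
  have H: "subgroup (C <#> T) G" by (rule normal_set_mult_subgroup)
  have pos: "card (C <#> T) > 0" using H by (rule card_subgroup_pos)
  have "multiplicity q (order G) \<le> multiplicity q (card (C <#> T))"
    if q: "Factorial_Ring.prime q" for q :: nat
  proof -
    interpret q: finite_group_prime G q using q by unfold_locales auto
    obtain Q where Q: "Sylow_subgroup q Q G" using q.Sylow_exists by blast
    have QG: "subgroup Q G" and cQ: "card Q = q ^ multiplicity q (order G)"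
      using Q by (auto simp: Sylow_subgroup_def)
    have "\<exists>K. subgroup K G \<and> K \<subseteq> C <#> T \<and> card K = q ^ multiplicity q (order G)"
    proof (cases "q = p")
      case True thus ?thesis using TG cT S_contained_in_set_mult by blast
    next
      case False
      have "x \<in> C" if x: "x \<in> Q" for x
      proof (rule p')
        show "x \<in> carrier G" using QG x by (rule subgroup.mem_carrier)
        obtain k where "ord x = q ^ k" using q.ord_p_power[OF q.Sylow_p_subgroup[OF Q] x] by blast
        moreover have "coprime q p" using False q prime_p by (simp add: primes_coprime)
        ultimately show "coprime (ord x) p" by simp
      qed
      hence "Q \<subseteq> C <#> T" using H_contained_in_set_mult by blast
      thus ?thesis using QG cQ by blast
    qed
    then obtain K where K: "subgroup K G" "K \<subseteq> C <#> T" "card K = q ^ multiplicity q (order G)"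
      by blast
    have "q ^ multiplicity q (order G) dvd card (C <#> T)"
      using card_subgroup_dvd_subgroup[OF K(1) H K(2)] K(3) by simp
    thus ?thesis using pos q by (intro multiplicity_geI) auto
  qed
  hence "order G dvd card (C <#> T)"
    using pos order_pos by (intro multiplicity_le_imp_dvd) auto
  hence "card (carrier G) \<le> card (C <#> T)" using pos by (simp add: order_def dvd_imp_le)
  thus ?thesis using subgroup.subset[OF H] by (metis card_seteq finite_carrier)
qed

section \<open>Fusion\<close>

text \<open>Says that each \<open>N\<^sub>G(Q)/C\<^sub>G(Q)\<close> is a \<open>p\<close>-group. Stated for elements, it passes to subgroups of
  \<open>G\<close> directly.\<close>

definition frobenius_condition where
  "frobenius_condition \<longleftrightarrow> (\<forall>Q. p_subgroup p Q G \<longrightarrow>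
     (\<forall>x \<in> normalizer G Q. coprime (ord x) p \<longrightarrow> x \<in> centralizer G Q))"

lemma normalizer_eq_centralizer_mult_Sylow:
  assumes F: "frobenius_condition" and D: "p_subgroup p D G"
    and T: "Sylow_subgroup p T (G\<lparr>carrier := normalizer G D\<rparr>)"
  shows "normalizer G D = centralizer G D <#> T"
proof -
  have DG: "subgroup D G" using D by (simp add: p_subgroup_def)
  have N: "subgroup (normalizer G D) G" using DG by (rule subgroup_normalizer)
  interpret N: finite_group_prime "G\<lparr>carrier := normalizer G D\<rparr>" p
    using N by (rule restrict_finite_group_prime)
  have "carrier (G\<lparr>carrier := normalizer G D\<rparr>) = centralizer G D <#>\<^bsub>G\<lparr>carrier := normalizer G D\<rparr>\<^esub> T"
    using F D N by (intro N.normal_mult_Sylow_eq_carrier centralizer_normal_in_normalizer DG T)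
      (simp add: frobenius_condition_def ord_restrict)
  thus ?thesis by simp
qed

text \<open>Downward induction on the order of \<open>D = P \<inter> R\<close>. The intersections of \<open>P\<close> and \<open>R\<close> with \<open>N\<^sub>G(D)\<close>
  are larger than \<open>D\<close> and lie in Sylow subgroups \<open>T\<close> and \<open>T'\<close> of \<open>N\<^sub>G(D)\<close>, which are conjugate by
  some \<open>c\<close> in \<open>C\<^sub>G(D)\<close>. If \<open>Q\<close> is a Sylow subgroup of \<open>G\<close> that contains \<open>T\<close>, induction leads from
  \<open>P\<close> to \<open>Q\<close> and from \<open>c Q c\<^sup>-\<^sup>1\<close> to \<open>R\<close>, and the elements it provides centralize \<open>D\<close> as well.\<close>

lemma Sylow_conjugate_by_centralizer:
  assumes F: "frobenius_condition"
  shows "Sylow_subgroup p P G \<Longrightarrow> Sylow_subgroup p R G \<Longrightarrow>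
    \<exists>c \<in> centralizer G (P \<inter> R). R = conjugate_set G c P"
proof (induction "order G - card (P \<inter> R)" arbitrary: P R rule: less_induct)
  case less
  let ?D = "P \<inter> R"
  note P = less.prems(1) and R = less.prems(2)
  have PG: "subgroup P G" and RG: "subgroup R G" and cPR: "card P = card R"
    using P R by (auto simp: Sylow_subgroup_def)
  have Ps: "P \<subseteq> carrier G" and Rs: "R \<subseteq> carrier G" using PG RG by (auto dest: subgroup.subset)
  have DG: "subgroup ?D G" using PG RG by (rule subgroups_Inter_pair)
  have Ds: "?D \<subseteq> carrier G" using Ps by auto
  have D: "p_subgroup p ?D G" using p_subgroup_mono[OF Sylow_p_subgroup[OF P] DG] by simp
  show ?case
  proof (cases "P = R")
    case True
    have "\<one> \<in> centralizer G ?D" using subgroup_centralizer[OF Ds] by (rule subgroup.one_closed)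
    thus ?thesis using True conjugate_set_one[OF Ps] by force
  next
    case False
    have finP: "finite P" and finR: "finite R" using PG RG by (auto intro: finite_subgroup)
    have "\<not> P \<subseteq> R" "\<not> R \<subseteq> P"
      using False cPR finP finR card_subset_eq[of R P] card_subset_eq[of P R] by auto
    hence DP: "?D \<subset> P" and DR: "?D \<subset> R" by auto
    let ?N = "normalizer G ?D" and ?C = "centralizer G ?D"
    have N: "subgroup ?N G" using DG by (rule subgroup_normalizer)
    have C: "subgroup ?C G" using Ds by (rule subgroup_centralizer)
    interpret N: finite_group_prime "G\<lparr>carrier := ?N\<rparr>" p
      using N by (rule restrict_finite_group_prime)
    have smaller: "order G - card (U \<inter> W) < order G - card ?D"
      if AN: "A \<inter> ?N \<subseteq> U \<inter> W" and A: "Sylow_subgroup p A G" and DA: "?D \<subset> A"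
        and U: "subgroup U G" for A U W
    proof -
      obtain g where g: "g \<in> A - ?D" "conjugate_set G g ?D = ?D"
        using normalizer_grows[OF Sylow_p_subgroup[OF A] DG DA] by blast
      have "A \<subseteq> carrier G" using A by (simp add: Sylow_subgroup_def subgroup.subset)
      hence "g \<in> ?N" using g Ds by (auto simp: mem_normalizer_iff)
      moreover have "?D \<subseteq> ?N" using DG by (rule subgroup_le_normalizer)
      ultimately have "?D \<subset> U \<inter> W" using g(1) AN DA by blast
      moreover have fin: "finite (U \<inter> W)" using finite_subgroup[OF U] by simp
      ultimately have "card ?D < card (U \<inter> W)" by (simp add: psubset_card_mono)
      moreover have "card (U \<inter> W) \<le> order G"
        using subgroup.subset[OF U] by (auto simp: order_def intro!: card_mono)
      ultimately show ?thesis by simp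
    qed
    have Sylow_over: "\<exists>T. Sylow_subgroup p T (G\<lparr>carrier := ?N\<rparr>) \<and> A \<inter> ?N \<subseteq> T"
      if "Sylow_subgroup p A G" for A
    proof (rule N.p_subgroup_le_Sylow)
      have AG: "subgroup A G" using that by (simp add: Sylow_subgroup_def)
      have "p_subgroup p (A \<inter> ?N) G"
        using p_subgroup_mono[OF Sylow_p_subgroup[OF that] subgroups_Inter_pair[OF AG N]] by simp
      thus "p_subgroup p (A \<inter> ?N) (G\<lparr>carrier := ?N\<rparr>)"
        using N by (auto simp: p_subgroup_def intro: subgroup_incl)
    qed
    obtain T where T: "Sylow_subgroup p T (G\<lparr>carrier := ?N\<rparr>)" "P \<inter> ?N \<subseteq> T"
      using Sylow_over[OF P] by blast
    obtain T' where T': "Sylow_subgroup p T' (G\<lparr>carrier := ?N\<rparr>)" "R \<inter> ?N \<subseteq> T'"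
      using Sylow_over[OF R] by blast
    have TG: "subgroup T G" using T(1) incl_subgroup[OF N] by (simp add: Sylow_subgroup_def)
    have Ts: "T \<subseteq> carrier G" using TG by (rule subgroup.subset)
    obtain n where n: "n \<in> ?N" "T' = conjugate_set G n T"
      using N.Sylow_conjugate[OF T(1) T'(1)] N by (auto simp: conjugate_set_restrict)
    \<comment> \<open>As \<open>N\<^sub>G(D) = C\<^sub>G(D) T\<close>, the conjugating element can be taken in \<open>C\<^sub>G(D)\<close>.\<close>
    have "n \<in> ?C <#> T"
      using n(1) normalizer_eq_centralizer_mult_Sylow[OF F D T(1)] by simp
    then obtain c t where ct: "c \<in> ?C" "t \<in> T" "n = c \<otimes> t" by (auto simp: set_mult_def)
    have cG: "c \<in> carrier G" and tG: "t \<in> carrier G"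
      using ct C TG by (auto intro: subgroup.mem_carrier)
    have "conjugate_set G t T = T"
      using ct(2) TG tG Ts by (intro conjugate_set_eqI)
        (auto intro!: subgroup.m_closed[OF TG] subgroup.m_inv_closed[OF TG])
    hence T'c: "T' = conjugate_set G c T"
      using n(2) ct(3) conjugate_set_mult[OF cG tG Ts] by simp
    have "p_subgroup p T G"
      using T(1) TG by (auto simp: Sylow_subgroup_def p_subgroup_def p_power_order_def)
    then obtain Q where Q: "Sylow_subgroup p Q G" "T \<subseteq> Q" using p_subgroup_le_Sylow by blast
    have QG: "subgroup Q G" using Q(1) by (simp add: Sylow_subgroup_def)
    have Qs: "Q \<subseteq> carrier G" using QG by (rule subgroup.subset)
    let ?Q = "conjugate_set G c Q"
    have Q': "Sylow_subgroup p ?Q G" using Q(1) cG by (rule Sylow_conjugate_set)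
    have QG': "subgroup ?Q G" using Q' by (simp add: Sylow_subgroup_def)
    have "T' \<subseteq> ?Q" using T'c Q(2) by (simp add: conjugate_set_mono)
    have le1: "P \<inter> ?N \<subseteq> P \<inter> Q" and le2: "R \<inter> ?N \<subseteq> ?Q \<inter> R"
      using T(2) Q(2) T'(2) \<open>T' \<subseteq> ?Q\<close> by auto
    obtain c1 where c1: "c1 \<in> centralizer G (P \<inter> Q)" "Q = conjugate_set G c1 P"
      using less.hyps[OF smaller[OF le1 P DP PG] P Q(1)] by blast
    obtain c2 where c2: "c2 \<in> centralizer G (?Q \<inter> R)" "R = conjugate_set G c2 ?Q"
      using less.hyps[OF smaller[OF le2 R DR QG'] Q' R] by blast
    have DN: "?D \<subseteq> ?N" using DG by (rule subgroup_le_normalizer)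
    have "c1 \<in> ?C" "c2 \<in> ?C"
      using c1(1) c2(1) le1 le2 DN centralizer_mono[of ?D "P \<inter> Q"] centralizer_mono[of ?D "?Q \<inter> R"]
      by auto
    moreover have "c1 \<in> carrier G" "c2 \<in> carrier G"
      using calculation C by (auto intro: subgroup.mem_carrier)
    ultimately have "R = conjugate_set G (c2 \<otimes> (c \<otimes> c1)) P" "c2 \<otimes> (c \<otimes> c1) \<in> ?C"
      using c1(2) c2(2) cG Ps ct(1) C
      by (simp_all add: conjugate_set_mult conjugate_set_subset subgroup.m_closed)
    thus ?thesis by blast
  qed
qed

text \<open>The element \<open>x\<close> lies in both \<open>S\<close> and \<open>g\<^sup>-\<^sup>1 S g\<close>. These are conjugate by an element that
  centralizes \<open>x\<close>, which corrects \<open>g\<close> to an element of \<open>N\<^sub>G(S) = C\<^sub>G(S) S\<close>.\<close>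

lemma Sylow_controls_fusion:
  assumes F: "frobenius_condition" and S: "Sylow_subgroup p S G"
    and x: "x \<in> S" and g: "g \<in> carrier G" and y: "g \<otimes> x \<otimes> inv g \<in> S"
  shows "\<exists>s \<in> S. g \<otimes> x \<otimes> inv g = s \<otimes> x \<otimes> inv s"
proof -
  have SG: "subgroup S G" using S by (simp add: Sylow_subgroup_def)
  have Ss: "S \<subseteq> carrier G" using SG by (rule subgroup.subset)
  have xG: "x \<in> carrier G" using SG x by (rule subgroup.mem_carrier)
  let ?R = "conjugate_set G (inv g) S"
  have R: "Sylow_subgroup p ?R G" using S g by (simp add: Sylow_conjugate_set)
  have "x = inv g \<otimes> (g \<otimes> x \<otimes> inv g) \<otimes> inv (inv g)"
    using g xG conjugation_is_surj[of "inv g" x] by simp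
  hence xR: "x \<in> ?R" using y unfolding conjugate_set_def by blast
  obtain c where c: "c \<in> centralizer G (S \<inter> ?R)" "?R = conjugate_set G c S"
    using Sylow_conjugate_by_centralizer[OF F S R] by blast
  have cG: "c \<in> carrier G" and cx: "c \<otimes> x = x \<otimes> c"
    using c(1) x xR by (auto simp: centralizer_def)
  have "conjugate_set G (g \<otimes> c) S = conjugate_set G g ?R"
    using c(2) g cG Ss by (simp add: conjugate_set_mult)
  also have "\<dots> = S" using g Ss by (simp add: conjugate_set_one flip: conjugate_set_mult)
  finally have "g \<otimes> c \<in> normalizer G S" using g cG Ss by (simp add: mem_normalizer_iff)
  moreover have "Sylow_subgroup p S (G\<lparr>carrier := normalizer G S\<rparr>)"
    using S SG by (simp add: Sylow_in_subgroup subgroup_normalizer subgroup_le_normalizer)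
  ultimately have "g \<otimes> c \<in> centralizer G S <#> S"
    using normalizer_eq_centralizer_mult_Sylow[OF F Sylow_p_subgroup[OF S]] by simp
  then obtain d s where ds: "d \<in> centralizer G S" "s \<in> S" "g \<otimes> c = d \<otimes> s"
    by (auto simp: set_mult_def)
  have dG: "d \<in> carrier G" using ds(1) by (simp add: centralizer_def)
  have sG: "s \<in> carrier G" using SG ds(2) by (rule subgroup.mem_carrier)
  have sxS: "s \<otimes> x \<otimes> inv s \<in> S"
    using SG x ds(2) by (simp add: subgroup.m_closed subgroup.m_inv_closed)
  have "g \<otimes> x \<otimes> inv g = g \<otimes> (c \<otimes> x \<otimes> inv c) \<otimes> inv g"
    using cx cG xG by (simp add: m_assoc)
  also have "\<dots> = (g \<otimes> c) \<otimes> x \<otimes> inv (g \<otimes> c)"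
    using g cG xG by (simp add: m_assoc inv_mult_group)
  also have "\<dots> = d \<otimes> (s \<otimes> x \<otimes> inv s) \<otimes> inv d"
    unfolding ds(3) using dG sG xG by (simp add: m_assoc inv_mult_group)
  also have "\<dots> = s \<otimes> x \<otimes> inv s"
    using ds(1) sxS dG sG xG conj_eq_self_iff[of d "s \<otimes> x \<otimes> inv s"] by (simp add: centralizer_def)
  finally show ?thesis using ds(2) by blast
qed

end

section \<open>Transfer\<close>

lemma (in group) mult_inv_cancel:
  assumes "x \<in> carrier G" "y \<in> carrier G"
  shows "x \<otimes> (inv x \<otimes> y) = y" "inv x \<otimes> (x \<otimes> y) = y"
  using assms by (simp_all flip: m_assoc)

lemma (in comm_group) mult_quotient_cancel:
  assumes "a \<in> carrier G" "b \<in> carrier G" "c \<in> carrier G"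
  shows "(a \<otimes> b) \<otimes> inv (a \<otimes> c) = b \<otimes> inv c"
    and "(b \<otimes> inv c) \<otimes> (a \<otimes> inv b) = a \<otimes> inv c"
proof -
  have "(a \<otimes> b) \<otimes> inv (a \<otimes> c) = (b \<otimes> a) \<otimes> (inv a \<otimes> inv c)"
    using assms by (simp add: m_comm inv_mult)
  thus "(a \<otimes> b) \<otimes> inv (a \<otimes> c) = b \<otimes> inv c"
    using assms by (simp add: m_assoc mult_inv_cancel)
  have "(b \<otimes> inv c) \<otimes> (a \<otimes> inv b) = (inv c \<otimes> b) \<otimes> (inv b \<otimes> a)"
    using assms by (simp add: m_comm)
  also have "\<dots> = inv c \<otimes> a" using assms by (simp add: m_assoc mult_inv_cancel)
  finally show "(b \<otimes> inv c) \<otimes> (a \<otimes> inv b) = a \<otimes> inv c" using assms by (simp add: m_comm)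
qed

lemma (in comm_group) conj_trivial:
  assumes "a \<in> carrier G" "b \<in> carrier G" shows "a \<otimes> b \<otimes> inv a = b"
proof -
  have "a \<otimes> b \<otimes> inv a = (b \<otimes> a) \<otimes> inv a" using assms by (simp add: m_comm)
  thus ?thesis using assms by (simp add: m_assoc)
qed

context group
begin

text \<open>On a double coset with representative \<open>r\<close> put \<open>\<phi>(u r v) = f(u) f(v)\<close>. If \<open>u r v = u' r v'\<close>,
  then conjugation by \<open>r\<close> takes the element \<open>v' v\<^sup>-\<^sup>1\<close> of \<open>S\<close> to \<open>u'\<^sup>-\<^sup>1 u\<close>, so \<open>f\<close> agrees on these two,
  which is what the value of \<open>\<phi>\<close> being well defined amounts to.\<close>

lemma biequivariant_extension:
  assumes S: "subgroup S G" and A: "comm_group A" and f: "f \<in> hom (G\<lparr>carrier := S\<rparr>) A"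
    and stable: "\<And>x g. x \<in> S \<Longrightarrow> g \<in> carrier G \<Longrightarrow> g \<otimes> x \<otimes> inv g \<in> S \<Longrightarrow>
      f (g \<otimes> x \<otimes> inv g) = f x"
  obtains \<phi> where "\<And>g. g \<in> carrier G \<Longrightarrow> \<phi> g \<in> carrier A"
    and "\<And>u g v. u \<in> S \<Longrightarrow> g \<in> carrier G \<Longrightarrow> v \<in> S \<Longrightarrow>
      \<phi> (u \<otimes> g \<otimes> v) = f u \<otimes>\<^bsub>A\<^esub> \<phi> g \<otimes>\<^bsub>A\<^esub> f v"
proof -
  interpret A: comm_group A by fact
  interpret S: group "G\<lparr>carrier := S\<rparr>" using S by (rule subgroup_imp_group)
  interpret f: group_hom "G\<lparr>carrier := S\<rparr>" A f using f by unfold_locales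
  have SG: "s \<in> carrier G" if "s \<in> S" for s using S that by (rule subgroup.mem_carrier)
  note [simp] = SG subgroup.m_closed[OF S] subgroup.m_inv_closed[OF S]
  have fc [simp]: "f s \<in> carrier A" if "s \<in> S" for s using that f.hom_closed by simp
  have fm: "f (s \<otimes> t) = f s \<otimes>\<^bsub>A\<^esub> f t" if "s \<in> S" "t \<in> S" for s t using that f.hom_mult[of s t] by simp
  have fi: "f (inv s) = inv\<^bsub>A\<^esub> f s" if "s \<in> S" for s
    using that f.hom_inv[of s] S by simp
  define dc where "dc g = {u \<otimes> g \<otimes> v | u v. u \<in> S \<and> v \<in> S}" for g
  define rep where "rep g = (SOME r. r \<in> dc g)" for g
  have one: "\<one> \<in> S" using S by (rule subgroup.one_closed)
  have dcI: "u \<otimes> g \<otimes> v \<in> dc g" if "u \<in> S" "v \<in> S" for u g v using that by (auto simp: dc_def)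
  have dc_self: "g \<in> dc g" if "g \<in> carrier G" for g
    using dcI[OF one one, of g] that by simp
  have dc_sub: "dc (u \<otimes> g \<otimes> v) \<subseteq> dc g" if "u \<in> S" "v \<in> S" "g \<in> carrier G" for u v g
  proof
    fix h assume "h \<in> dc (u \<otimes> g \<otimes> v)"
    then obtain a b where ab: "a \<in> S" "b \<in> S" "h = a \<otimes> (u \<otimes> g \<otimes> v) \<otimes> b" by (auto simp: dc_def)
    hence "h = (a \<otimes> u) \<otimes> g \<otimes> (v \<otimes> b)" using that by (simp add: m_assoc)
    thus "h \<in> dc g" using dcI[of "a \<otimes> u" "v \<otimes> b" g] ab(1,2) that by simp
  qed
  have dc_eq: "dc (u \<otimes> g \<otimes> v) = dc g" if "u \<in> S" "v \<in> S" "g \<in> carrier G" for u v g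
  proof
    have "g = inv u \<otimes> (u \<otimes> g \<otimes> v) \<otimes> inv v" using that by (simp add: m_assoc mult_inv_cancel)
    thus "dc g \<subseteq> dc (u \<otimes> g \<otimes> v)"
      using dc_sub[of "inv u" "inv v" "u \<otimes> g \<otimes> v"] that by simp
  qed (use dc_sub that in auto)
  have rep_mem: "rep g \<in> dc g" if "g \<in> carrier G" for g
    unfolding rep_def using dc_self[OF that] by (rule someI)
  have repG: "rep g \<in> carrier G" if "g \<in> carrier G" for g
    using rep_mem[OF that] that by (auto simp: dc_def)
  have decomp: "\<exists>u v. u \<in> S \<and> v \<in> S \<and> g = u \<otimes> rep g \<otimes> v" if g: "g \<in> carrier G" for g
  proof -
    obtain u v where uv: "u \<in> S" "v \<in> S" "rep g = u \<otimes> g \<otimes> v" using rep_mem[OF g] by (auto simp: dc_def)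
    hence "g \<in> dc (rep g)" using dc_eq[of u v g] dc_self[OF g] g by simp
    thus ?thesis by (auto simp: dc_def)
  qed
  have wd: "f u \<otimes>\<^bsub>A\<^esub> f v = f u' \<otimes>\<^bsub>A\<^esub> f v'"
    if uv: "u \<in> S" "v \<in> S" "u' \<in> S" "v' \<in> S" and r: "r \<in> carrier G"
      and eq: "u \<otimes> r \<otimes> v = u' \<otimes> r \<otimes> v'" for u v u' v' r
  proof -
    have "inv u' \<otimes> u \<otimes> r = inv u' \<otimes> (u \<otimes> r \<otimes> v) \<otimes> inv v"
      using uv r by (simp add: m_assoc)
    also have "\<dots> = r \<otimes> (v' \<otimes> inv v)"
      unfolding eq using uv r by (simp add: m_assoc mult_inv_cancel)
    finally have "r \<otimes> (v' \<otimes> inv v) \<otimes> inv r = inv u' \<otimes> u"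
      using uv r inv_solve_right'[of "inv u' \<otimes> u" "r \<otimes> (v' \<otimes> inv v)" r] by simp
    hence "f (inv u' \<otimes> u) = f (v' \<otimes> inv v)"
      using stable[of "v' \<otimes> inv v" r] uv r by simp
    hence "inv\<^bsub>A\<^esub> f u' \<otimes>\<^bsub>A\<^esub> f u = f v' \<otimes>\<^bsub>A\<^esub> inv\<^bsub>A\<^esub> f v" using uv by (simp add: fm fi)
    hence "f u' \<otimes>\<^bsub>A\<^esub> (inv\<^bsub>A\<^esub> f u' \<otimes>\<^bsub>A\<^esub> f u) \<otimes>\<^bsub>A\<^esub> f v = f u' \<otimes>\<^bsub>A\<^esub> (f v' \<otimes>\<^bsub>A\<^esub> inv\<^bsub>A\<^esub> f v) \<otimes>\<^bsub>A\<^esub> f v" by simp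
    thus ?thesis using uv by (simp add: A.m_assoc A.mult_inv_cancel)
  qed
  define \<phi> where "\<phi> g = (THE a. \<exists>u v. u \<in> S \<and> v \<in> S \<and> g = u \<otimes> rep g \<otimes> v \<and> a = f u \<otimes>\<^bsub>A\<^esub> f v)" for g
  have \<phi>: "\<phi> g = f u \<otimes>\<^bsub>A\<^esub> f v" if "g \<in> carrier G" "u \<in> S" "v \<in> S" "g = u \<otimes> rep g \<otimes> v" for g u v
    unfolding \<phi>_def
  proof (rule the_equality)
    show "\<exists>u' v'. u' \<in> S \<and> v' \<in> S \<and> g = u' \<otimes> rep g \<otimes> v' \<and> f u \<otimes>\<^bsub>A\<^esub> f v = f u' \<otimes>\<^bsub>A\<^esub> f v'"
      using that by blast
  next
    fix a assume "\<exists>u' v'. u' \<in> S \<and> v' \<in> S \<and> g = u' \<otimes> rep g \<otimes> v' \<and> a = f u' \<otimes>\<^bsub>A\<^esub> f v'"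
    then obtain u' v' where *: "u' \<in> S" "v' \<in> S" "g = u' \<otimes> rep g \<otimes> v'" "a = f u' \<otimes>\<^bsub>A\<^esub> f v'" by blast
    thus "a = f u \<otimes>\<^bsub>A\<^esub> f v" using wd[OF *(1,2) that(2,3) repG[OF that(1)]] that(4) by simp
  qed
  show thesis
  proof
    fix g assume g: "g \<in> carrier G"
    obtain u v where uv: "u \<in> S" "v \<in> S" "g = u \<otimes> rep g \<otimes> v" using decomp[OF g] by blast
    show "\<phi> g \<in> carrier A" using \<phi>[OF g uv] uv by simp
    fix s t assume st: "s \<in> S" "t \<in> S"
    have rep_eq: "rep (s \<otimes> g \<otimes> t) = rep g" using dc_eq[OF st g] by (simp add: rep_def)
    have "s \<otimes> g \<otimes> t = s \<otimes> (u \<otimes> rep g \<otimes> v) \<otimes> t" using uv(3) by simp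
    also have "\<dots> = (s \<otimes> u) \<otimes> rep (s \<otimes> g \<otimes> t) \<otimes> (v \<otimes> t)"
      unfolding rep_eq using uv(1,2) st repG[OF g] by (simp add: m_assoc)
    finally have "\<phi> (s \<otimes> g \<otimes> t) = f (s \<otimes> u) \<otimes>\<^bsub>A\<^esub> f (v \<otimes> t)"
      using uv(1,2) st g by (intro \<phi>) auto
    thus "\<phi> (s \<otimes> g \<otimes> t) = f s \<otimes>\<^bsub>A\<^esub> \<phi> g \<otimes>\<^bsub>A\<^esub> f t"
      using \<phi>[OF g uv] uv(1,2) st by (simp add: fm A.m_assoc)
  qed
qed

lemma bij_betw_rcosets_mult:
  assumes S: "subgroup S G" and x: "x \<in> carrier G"
  shows "bij_betw (\<lambda>C. C #> x) (rcosets S) (rcosets S)"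
proof -
  have sub: "C \<subseteq> carrier G" if "C \<in> rcosets S" for C
    using S is_group that by (rule subgroup.rcosets_carrier)
  have closed: "C #> y \<in> rcosets S" if "C \<in> rcosets S" "y \<in> carrier G" for C y
    using that subgroup.subset[OF S] by (auto simp: RCOSETS_def coset_mult_assoc)
  show ?thesis
    by (rule bij_betw_byWitness[of _ "\<lambda>C. C #> inv x"])
       (use x sub closed in \<open>auto simp: coset_mult_assoc\<close>)
qed

text \<open>The transfer is \<open>V(x) = \<Prod> \<phi>(g x) / \<phi>(g)\<close> over the cosets \<open>S g\<close>, with \<open>\<phi>\<close> a biequivariant
  extension of \<open>f\<close>. Equivariance on the left makes each factor independent of the representative,
  and \<open>V\<close> is a homomorphism because \<open>x\<close> permutes the cosets. Equivariance on the right makes each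
  factor of \<open>V(s)\<close> equal to \<open>f(s)\<close>, which replaces the usual evaluation along the cycles of \<open>s\<close>.\<close>

lemma transfer_exists:
  assumes S: "subgroup S G" and A: "comm_group A" and f: "f \<in> hom (G\<lparr>carrier := S\<rparr>) A"
    and stable: "\<And>x g. x \<in> S \<Longrightarrow> g \<in> carrier G \<Longrightarrow> g \<otimes> x \<otimes> inv g \<in> S \<Longrightarrow>
      f (g \<otimes> x \<otimes> inv g) = f x"
  obtains V where "V \<in> hom G A" and "\<And>s. s \<in> S \<Longrightarrow> V s = f s [^]\<^bsub>A\<^esub> card (rcosets S)"
proof -
  interpret A: comm_group A by fact
  obtain \<phi> where \<phi>c: "\<And>g. g \<in> carrier G \<Longrightarrow> \<phi> g \<in> carrier A"
    and \<phi>eq: "\<And>u g v. u \<in> S \<Longrightarrow> g \<in> carrier G \<Longrightarrow> v \<in> S \<Longrightarrow>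
      \<phi> (u \<otimes> g \<otimes> v) = f u \<otimes>\<^bsub>A\<^esub> \<phi> g \<otimes>\<^bsub>A\<^esub> f v"
    using biequivariant_extension[OF S A f stable] by blast
  have SG: "s \<in> carrier G" if "s \<in> S" for s using S that by (rule subgroup.mem_carrier)
  have one: "\<one> \<in> S" using S by (rule subgroup.one_closed)
  have fc: "f s \<in> carrier A" if "s \<in> S" for s using f that by (auto simp: hom_def)
  have f1: "f \<one> = \<one>\<^bsub>A\<^esub>"
    using hom_one[OF f subgroup_imp_group[OF S] A.is_group] by simp
  have left: "\<phi> (u \<otimes> g) = f u \<otimes>\<^bsub>A\<^esub> \<phi> g" if "u \<in> S" "g \<in> carrier G" for u g
    using \<phi>eq[OF that one] that SG fc \<phi>c f1 by simp
  have right: "\<phi> (g \<otimes> v) = \<phi> g \<otimes>\<^bsub>A\<^esub> f v" if "v \<in> S" "g \<in> carrier G" for v g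
    using \<phi>eq[OF one that(2,1)] that SG fc \<phi>c f1 by simp
  define q where "q x g = \<phi> (g \<otimes> x) \<otimes>\<^bsub>A\<^esub> inv\<^bsub>A\<^esub> \<phi> g" for x g
  define \<delta> where "\<delta> x C = q x (SOME g. g \<in> C)" for x C
  define V where "V x = finprod A (\<delta> x) (rcosets S)" for x
  have CG: "g \<in> carrier G" if "C \<in> rcosets S" "g \<in> C" for C g
    using subgroup.rcosets_carrier[OF S is_group that(1)] that(2) by blast
  have qc: "q x g \<in> carrier A" if "x \<in> carrier G" "g \<in> carrier G" for x g
    using that \<phi>c by (simp add: q_def)
  have q_cong: "q x (s \<otimes> g) = q x g" if "s \<in> S" "g \<in> carrier G" "x \<in> carrier G" for x s g
  proof -
    have "q x (s \<otimes> g) = (f s \<otimes>\<^bsub>A\<^esub> \<phi> (g \<otimes> x)) \<otimes>\<^bsub>A\<^esub> inv\<^bsub>A\<^esub> (f s \<otimes>\<^bsub>A\<^esub> \<phi> g)"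
      using that SG left by (simp add: q_def m_assoc)
    also have "\<dots> = q x g"
      using that fc \<phi>c by (simp add: q_def A.mult_quotient_cancel)
    finally show ?thesis .
  qed
  have \<delta>: "\<delta> x C = q x g" if C: "C \<in> rcosets S" and g: "g \<in> C" and x: "x \<in> carrier G" for x C g
  proof -
    have r: "(SOME g. g \<in> C) \<in> C" using g by (rule someI)
    obtain c where c: "c \<in> carrier G" "C = S #> c" using C by (auto simp: RCOSETS_def)
    obtain s t where "s \<in> S" "t \<in> S" "g = s \<otimes> c" "(SOME g. g \<in> C) = t \<otimes> c"
      using r g c by (auto simp: r_coset_def)
    thus ?thesis using q_cong c(1) x by (simp add: \<delta>_def)
  qed
  have ne: "\<exists>g. g \<in> C" if "C \<in> rcosets S" for C
    using subgroup.rcosets_non_empty[OF S that] by blast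
  have \<delta>c: "\<delta> x C \<in> carrier A" if "C \<in> rcosets S" "x \<in> carrier G" for x C
    using ne[OF that(1)] \<delta>[OF that(1) _ that(2)] qc[OF that(2) CG[OF that(1)]] by metis
  have mult: "V (x \<otimes> y) = V x \<otimes>\<^bsub>A\<^esub> V y" if x: "x \<in> carrier G" and y: "y \<in> carrier G" for x y
  proof -
    have bij: "bij_betw (\<lambda>C. C #> x) (rcosets S) (rcosets S)" using S x by (rule bij_betw_rcosets_mult)
    have Cx: "C #> x \<in> rcosets S" if "C \<in> rcosets S" for C
      using bij that by (rule bij_betw_apply)
    have split: "\<delta> (x \<otimes> y) C = \<delta> x C \<otimes>\<^bsub>A\<^esub> \<delta> y (C #> x)" if C: "C \<in> rcosets S" for C
    proof -
      obtain g where g: "g \<in> C" using ne[OF C] by blast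
      have gG: "g \<in> carrier G" using C g by (rule CG)
      have "g \<otimes> x \<in> C #> x" using g by (auto simp: r_coset_def)
      hence "\<delta> y (C #> x) = q y (g \<otimes> x)" using \<delta>[OF Cx[OF C]] y by blast
      moreover have "q (x \<otimes> y) g = q x g \<otimes>\<^bsub>A\<^esub> q y (g \<otimes> x)"
        unfolding q_def using x y gG \<phi>c
        by (simp add: m_assoc A.mult_quotient_cancel)
      ultimately show ?thesis using \<delta>[OF C g] x y by simp
    qed
    have "V (x \<otimes> y) = finprod A (\<lambda>C. \<delta> x C \<otimes>\<^bsub>A\<^esub> \<delta> y (C #> x)) (rcosets S)"
      unfolding V_def using x y Cx \<delta>c
      by (intro A.finprod_cong' split) auto
    also have "\<dots> = V x \<otimes>\<^bsub>A\<^esub> finprod A (\<lambda>C. \<delta> y (C #> x)) (rcosets S)"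
      unfolding V_def using x y Cx \<delta>c by (intro A.finprod_multf) auto
    also have "finprod A (\<lambda>C. \<delta> y (C #> x)) (rcosets S) = finprod A (\<delta> y) ((\<lambda>C. C #> x) ` (rcosets S))"
      using y bij \<delta>c by (intro A.finprod_reindex[symmetric]) (auto simp: bij_betw_def)
    also have "\<dots> = V y" using bij by (simp add: V_def bij_betw_def)
    finally show ?thesis .
  qed
  have "V \<in> hom G A"
    using mult \<delta>c by (auto simp: hom_def V_def intro!: A.finprod_closed)
  moreover have "V s = f s [^]\<^bsub>A\<^esub> card (rcosets S)" if s: "s \<in> S" for s
  proof -
    have "\<delta> s C = f s" if C: "C \<in> rcosets S" for C
    proof -
      obtain g where g: "g \<in> C" using ne[OF C] by blast
      have gG: "g \<in> carrier G" using C g by (rule CG)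
      have "q s g = f s"
        unfolding q_def using s gG right fc \<phi>c by (simp add: A.conj_trivial)
      thus ?thesis using \<delta>[OF C g SG[OF s]] by simp
    qed
    hence "V s = finprod A (\<lambda>_. f s) (rcosets S)"
      unfolding V_def using s fc by (intro A.finprod_cong') auto
    thus ?thesis using s fc by (simp add: A.finprod_const)
  qed
  ultimately show thesis by (rule that)
qed

end

section \<open>Frobenius' normal complement theorem\<close>

lemma (in group) center_normal: "center G \<lhd> G"
proof (rule normal_invI)
  show "subgroup (center G) G" unfolding center_def by (rule subgroup_centralizer) simp
  show "x \<otimes> z \<otimes> inv x \<in> center G" if "x \<in> carrier G" "z \<in> center G" for x z
  proof -
    have "z \<in> carrier G" "x \<otimes> z = z \<otimes> x" using that by (auto simp: center_def centralizer_def)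
    thus ?thesis using that by (simp add: m_assoc)
  qed
qed

lemma (in group) pow_mem_of_order_quotient_dvd:
  assumes N: "N \<lhd> G" and x: "x \<in> carrier G" and n: "order (G Mod N) dvd n"
  shows "x [^] n \<in> N"
proof -
  interpret N: normal N G by fact
  interpret Q: group "G Mod N" by (rule N.factorgroup_is_group)
  have c: "N #> x \<in> carrier (G Mod N)" using x by (auto simp: carrier_FactGroup)
  have "(N #> x) [^]\<^bsub>G Mod N\<^esub> n = \<one>\<^bsub>G Mod N\<^esub>"
    using n Q.ord_dvd_group_order[OF c] Q.pow_eq_id[OF c] by (metis dvd_trans)
  hence "N #> (x [^] n) = N" using x by (simp add: N.FactGroup_pow)
  thus ?thesis using x by (metis N.is_subgroup nat_pow_closed rcos_self)
qed

context finite_group_prime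
begin

lemma p_power_eq_one_iff: "p ^ k = 1 \<longleftrightarrow> k = 0"
  using prime_gt_1_nat[OF prime_p] by (metis less_irrefl neq0_conv one_less_power power_0)

lemma coprime_p_power_iff: "coprime (p ^ k) p \<longleftrightarrow> k = 0"
  using prime_gt_1_nat[OF prime_p] by simp

text \<open>Modulo a maximal proper normal subgroup, a \<open>p\<close>-group has no normal subgroups besides the trivial
  ones, so its centre, being nontrivial, is the whole quotient.\<close>

lemma p_group_abelian_quotient:
  assumes P: "p_power_order p (carrier G)" and nontriv: "carrier G \<noteq> {\<one>}"
  obtains M where "M \<lhd> G" "M \<noteq> carrier G" "comm_group (G Mod M)"
proof -
  let ?F = "{N. N \<lhd> G \<and> N \<noteq> carrier G}"
  have sub: "N \<subseteq> carrier G" if "N \<lhd> G" for N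
    using that by (simp add: normal_imp_subgroup subgroup.subset)
  hence "?F \<subseteq> Pow (carrier G)" by auto
  hence "finite ?F" by (simp add: finite_subset)
  moreover have "{\<one>} \<in> ?F" using nontriv one_is_normal by simp
  ultimately obtain M where M: "M \<in> ?F" and max: "\<forall>N \<in> ?F. M \<subseteq> N \<longrightarrow> M = N"
    using finite_has_maximal[of ?F] by (metis (lifting) empty_iff)
  have MG: "M \<lhd> G" "M \<noteq> carrier G" using M by auto
  interpret M: normal M G by (rule MG(1))
  interpret Q: finite_group_prime "G Mod M" p using MG(1) by (rule quotient_finite_group_prime)
  let ?Z = "{x \<in> carrier G. M #> x \<in> center (G Mod M)}"
  have "?Z \<lhd> G"
    using M.factgroup_subgroup_union_normal[OF Q.center_normal]
      M.factgroup_subgroup_union_char[OF normal_imp_subgroup[OF Q.center_normal]] by simp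
  have lag: "order (G Mod M) * card M = order G"
    using lagrange[OF M.is_subgroup] by (simp add: order_def FactGroup_def)
  have "p_power_order p (carrier (G Mod M))"
  proof (rule p_power_order_dvd[OF P])
    show "card (carrier (G Mod M)) dvd card (carrier G)"
      using lag by (metis dvd_triv_left order_def)
  qed
  moreover have "carrier (G Mod M) \<noteq> {\<one>\<^bsub>G Mod M\<^esub>}"
  proof
    assume "carrier (G Mod M) = {\<one>\<^bsub>G Mod M\<^esub>}"
    hence "card M = card (carrier G)" using lag by (simp add: order_def)
    thus False using MG sub[OF MG(1)] by (simp add: card_subset_eq)
  qed
  ultimately have "center (G Mod M) \<noteq> {\<one>\<^bsub>G Mod M\<^esub>}" by (rule Q.center_nontrivial)
  moreover have "\<one>\<^bsub>G Mod M\<^esub> \<in> center (G Mod M)"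
    by (rule subgroup.one_closed[OF normal_imp_subgroup[OF Q.center_normal]])
  ultimately obtain C where C: "C \<in> center (G Mod M)" "C \<noteq> \<one>\<^bsub>G Mod M\<^esub>" by blast
  hence "C \<in> carrier (G Mod M)" by (simp add: center_def centralizer_def)
  then obtain x where x: "x \<in> carrier G" "C = M #> x" by (auto simp: carrier_FactGroup)
  have "M \<subseteq> ?Z"
  proof
    fix m assume m: "m \<in> M"
    hence "M #> m = \<one>\<^bsub>G Mod M\<^esub>" by (simp add: coset_join2 M.is_subgroup)
    thus "m \<in> ?Z" using m \<open>\<one>\<^bsub>G Mod M\<^esub> \<in> center (G Mod M)\<close> by simp
  qed
  moreover have "x \<in> ?Z" using x C by simp
  moreover have "x \<notin> M" using x C by (auto simp: coset_join2 M.is_subgroup)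
  ultimately have "?Z \<noteq> M" "M \<subseteq> ?Z" by blast+
  hence Z: "?Z = carrier G" using max \<open>?Z \<lhd> G\<close> by blast
  have "a \<otimes>\<^bsub>G Mod M\<^esub> b = b \<otimes>\<^bsub>G Mod M\<^esub> a"
    if "a \<in> carrier (G Mod M)" "b \<in> carrier (G Mod M)" for a b
  proof -
    obtain y where "y \<in> carrier G" "a = M #> y" using \<open>a \<in> carrier (G Mod M)\<close> by (auto simp: carrier_FactGroup)
    hence "a \<in> center (G Mod M)" using Z by blast
    thus ?thesis using that(2) by (simp add: center_def centralizer_def)
  qed
  hence "comm_group (G Mod M)" by (intro Q.group_comm_groupI)
  thus thesis using that MG by blast
qed

text \<open>The complement theorem is phrased through the set of \<open>p'\<close>-elements: they form a subgroup
  exactly if there is a normal \<open>p\<close>-complement, which then is that subgroup.\<close>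

definition p'_elements where
  "p'_elements = {x \<in> carrier G. coprime (ord x) p}"

end

lemma (in group) ord_conj:
  assumes "g \<in> carrier G" "x \<in> carrier G"
  shows "ord (g \<otimes> x \<otimes> inv g) = ord x"
proof -
  have pow: "(g \<otimes> x \<otimes> inv g) [^] (n::nat) = g \<otimes> x [^] n \<otimes> inv g" for n
    using assms by (induction n) (simp_all add: conj_mult)
  have "g \<otimes> y \<otimes> inv g = \<one> \<longleftrightarrow> y = \<one>" if "y \<in> carrier G" for y
    using assms(1) that by (metis conjugation_is_inj inv_closed one_closed r_inv r_one)
  hence "(g \<otimes> x \<otimes> inv g) [^] (n::nat) = \<one> \<longleftrightarrow> x [^] n = \<one>" for n
    using assms by (simp add: pow)
  thus ?thesis by (simp add: ord_def)
qed

lemma (in group_hom) ord_hom_dvd: "x \<in> carrier G \<Longrightarrow> H.ord (h x) dvd G.ord x"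
  by (metis G.pow_ord_eq_1 H.pow_eq_id hom_closed hom_nat_pow hom_one)

context finite_group_prime
begin

lemma frobenius_condition_subgroup:
  assumes F: "frobenius_condition" and N: "subgroup N G"
  shows "finite_group_prime.frobenius_condition (G\<lparr>carrier := N\<rparr>) p"
proof -
  interpret N: finite_group_prime "G\<lparr>carrier := N\<rparr>" p using N by (rule restrict_finite_group_prime)
  show ?thesis unfolding N.frobenius_condition_def
  proof (intro allI impI ballI)
    fix Q x
    assume Q: "p_subgroup p Q (G\<lparr>carrier := N\<rparr>)" and x: "x \<in> normalizer (G\<lparr>carrier := N\<rparr>) Q"
      and p': "coprime (N.ord x) p"
    have QN: "Q \<subseteq> N" using Q subgroup.subset by (fastforce simp: p_subgroup_def)
    have QG: "subgroup Q G" "p_subgroup p Q G"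
      using Q incl_subgroup[OF N] by (auto simp: p_subgroup_def)
    have xN: "x \<in> N" "conjugate_set G x Q = Q"
      using x QN N by (auto simp: N.mem_normalizer_iff conjugate_set_restrict)
    have xG: "x \<in> carrier G" using N xN(1) by (rule subgroup.mem_carrier)
    have "x \<in> normalizer G Q"
      using xG xN(2) subgroup.subset[OF QG(1)] by (simp add: mem_normalizer_iff)
    hence "x \<in> centralizer G Q"
      using F QG(2) p' N by (simp add: frobenius_condition_def ord_restrict)
    thus "x \<in> centralizer (G\<lparr>carrier := N\<rparr>) Q" using xN(1) by (simp add: centralizer_def)
  qed
qed

end

text \<open>Let \<open>M\<close> be a proper normal subgroup of a Sylow subgroup \<open>S\<close> with abelian quotient \<open>A = S/M\<close>.
  Control of fusion makes the projection \<open>S \<rightarrow> A\<close> stable, so it has a transfer \<open>V\<close>. Since \<open>A\<close> is a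
  \<open>p\<close>-group, the kernel of \<open>V\<close> contains all \<open>p'\<close>-elements of \<open>G\<close>; it is a proper subgroup and
  inherits the condition, so induction applies to it.\<close>

theorem frobenius_normal_complement:
  assumes "finite_group_prime G p" "finite_group_prime.frobenius_condition G p"
  shows "subgroup (finite_group_prime.p'_elements G p) G"
  using assms
proof (induction "order G" arbitrary: G rule: less_induct)
  case less
  interpret finite_group_prime G p by (rule less.prems(1))
  note F = less.prems(2)
  obtain S where S: "Sylow_subgroup p S G" using Sylow_exists by blast
  have SG: "subgroup S G" and cS: "card S = p ^ multiplicity p (order G)"
    using S by (auto simp: Sylow_subgroup_def)
  interpret S: finite_group_prime "G\<lparr>carrier := S\<rparr>" p using SG by (rule restrict_finite_group_prime)
  show ?case
  proof (cases "S = {\<one>\<^bsub>G\<^esub>}")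
    case True
    hence "multiplicity p (order G) = 0" using cS p_power_eq_one_iff[of "multiplicity p (order G)"] by (simp del: One_nat_def)
    hence "\<not> p dvd order G"
      using order_pos prime_p prime_multiplicity_gt_zero_iff[of p "order G"] by auto
    hence "coprime (order G) p" using prime_p by (simp add: coprime_commute prime_imp_coprime)
    hence "coprime (ord x) p" if "x \<in> carrier G" for x
      using ord_dvd_group_order[OF that] by (meson coprime_divisors dvd_refl)
    hence "p'_elements = carrier G" by (auto simp: p'_elements_def)
    thus ?thesis by (simp add: subgroup_self)
  next
    case False
    have pS: "p_power_order p S" using cS by (auto simp: p_power_order_def)
    obtain M where M: "M \<lhd> G\<lparr>carrier := S\<rparr>" "M \<noteq> S" "comm_group (G\<lparr>carrier := S\<rparr> Mod M)"
      using S.p_group_abelian_quotient pS False by auto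
    interpret M: normal M "G\<lparr>carrier := S\<rparr>" by (rule M(1))
    define A where "A = G\<lparr>carrier := S\<rparr> Mod M"
    interpret A: comm_group A unfolding A_def by (rule M(3))
    define f where "f x = M #>\<^bsub>G\<lparr>carrier := S\<rparr>\<^esub> x" for x
    have f: "f \<in> hom (G\<lparr>carrier := S\<rparr>) A"
      using M.r_coset_hom_Mod unfolding A_def f_def .
    interpret f: group_hom "G\<lparr>carrier := S\<rparr>" A f using f by unfold_locales
    have "f (g \<otimes>\<^bsub>G\<^esub> x \<otimes>\<^bsub>G\<^esub> inv\<^bsub>G\<^esub> g) = f x"
      if x: "x \<in> S" and g: "g \<in> carrier G" and gx: "g \<otimes>\<^bsub>G\<^esub> x \<otimes>\<^bsub>G\<^esub> inv\<^bsub>G\<^esub> g \<in> S" for x g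
    proof -
      obtain s where s: "s \<in> S" "g \<otimes>\<^bsub>G\<^esub> x \<otimes>\<^bsub>G\<^esub> inv\<^bsub>G\<^esub> g = s \<otimes>\<^bsub>G\<^esub> x \<otimes>\<^bsub>G\<^esub> inv\<^bsub>G\<^esub> s"
        using Sylow_controls_fusion[OF F S x g gx] by blast
      have "f (s \<otimes>\<^bsub>G\<^esub> x \<otimes>\<^bsub>G\<^esub> inv\<^bsub>G\<^esub> s) = f s \<otimes>\<^bsub>A\<^esub> f x \<otimes>\<^bsub>A\<^esub> inv\<^bsub>A\<^esub> f s"
        using f.hom_mult[of "s \<otimes>\<^bsub>G\<^esub> x" "inv\<^bsub>G\<^esub> s"] f.hom_mult[of s x] f.hom_inv[of s] s(1) x SG
        by (simp add: subgroup.m_closed subgroup.m_inv_closed)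
      also have "\<dots> = f x" using f.hom_closed[of s] f.hom_closed[of x] s(1) x A.conj_trivial by simp
      finally show ?thesis using s(2) by simp
    qed
    then obtain V where V: "V \<in> hom G A"
      and VS: "\<And>s. s \<in> S \<Longrightarrow> V s = f s [^]\<^bsub>A\<^esub> card (rcosets\<^bsub>G\<^esub> S)"
      using transfer_exists[OF SG A.comm_group_axioms f] by blast
    interpret V: group_hom G A V using V by unfold_locales
    have "order A * card M = card S"
      using S.lagrange[OF M.is_subgroup] unfolding A_def by (simp add: order_def FactGroup_def)
    hence "order A dvd p ^ multiplicity p (order G)" using cS by (metis dvd_triv_left)
    hence ordA: "\<exists>k. A.ord a = p ^ k" if "a \<in> carrier A" for a
      using A.ord_dvd_group_order[OF that] divides_primepow_nat[OF prime_p] by (meson dvd_trans)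
    let ?N = "kernel G A V"
    have N: "?N \<lhd> G" by (rule V.normal_kernel)
    have NG: "subgroup ?N G" by (rule V.subgroup_kernel)
    interpret N: finite_group_prime "G\<lparr>carrier := ?N\<rparr>" p
      using NG by (rule restrict_finite_group_prime)
    \<comment> \<open>The index of \<open>S\<close> is prime to \<open>p\<close>, so \<open>V\<close> does not vanish on \<open>S - M\<close>.\<close>
    have "?N \<noteq> carrier G"
    proof
      assume eq: "?N = carrier G"
      have "M \<subseteq> S" using M.subset by simp
      then obtain s where s: "s \<in> S" "s \<notin> M" using M(2) by blast
      have fs: "f s \<in> carrier A" using f.hom_closed s(1) by simp
      have "V s = \<one>\<^bsub>A\<^esub>" using eq s(1) SG by (auto simp: kernel_def dest: subgroup.mem_carrier)
      hence "A.ord (f s) dvd card (rcosets\<^bsub>G\<^esub> S)" using VS[OF s(1)] A.pow_eq_id[OF fs] by simp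
      moreover obtain k where k: "A.ord (f s) = p ^ k" using ordA[OF fs] by blast
      ultimately have "k = 0" using not_dvd_index_Sylow[OF S] by (metis dvd_power dvd_trans not_gr_zero)
      hence "f s = \<one>\<^bsub>A\<^esub>" using k A.ord_eq_1[OF fs] by simp
      hence "M #>\<^bsub>G\<lparr>carrier := S\<rparr>\<^esub> s = M" by (simp add: A_def f_def)
      hence "s \<in> M" using S.rcos_self[of s M] s(1) M.is_subgroup by simp
      thus False using s(2) by simp
    qed
    hence "?N \<subset> carrier G" using subgroup.subset[OF NG] by blast
    hence "order (G\<lparr>carrier := ?N\<rparr>) < order G" by (simp add: order_def psubset_card_mono)
    hence sub: "subgroup N.p'_elements (G\<lparr>carrier := ?N\<rparr>)"
      using less.hyps N.finite_group_prime_axioms frobenius_condition_subgroup[OF F NG] by blast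
    have "x \<in> ?N" if x: "x \<in> carrier G" "coprime (ord x) p" for x
    proof -
      obtain k where k: "A.ord (V x) = p ^ k" using ordA x(1) V.hom_closed by blast
      hence "p ^ k dvd ord x" using V.ord_hom_dvd[OF x(1)] by simp
      hence "coprime (p ^ k) p" using x(2) by (meson coprime_divisors dvd_refl)
      hence "k = 0" using coprime_p_power_iff by blast
      hence "V x = \<one>\<^bsub>A\<^esub>" using k A.ord_eq_1 x(1) V.hom_closed by simp
      thus ?thesis using x(1) by (simp add: kernel_def)
    qed
    hence "p'_elements = N.p'_elements"
      using NG subgroup.subset[OF NG] by (auto simp: p'_elements_def N.p'_elements_def ord_restrict)
    thus ?thesis using sub incl_subgroup[OF NG] by simp
  qed
qed

context finite_group_prime
begin

lemma p'_elements_normal: "subgroup p'_elements G \<Longrightarrow> p'_elements \<lhd> G"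
  by (rule normal_invI) (auto simp: p'_elements_def ord_conj)

text \<open>Its Sylow \<open>p\<close>-subgroup is trivial, since the orders of the elements of that subgroup are both
  powers of \<open>p\<close> and prime to \<open>p\<close>.\<close>

lemma coprime_card_p'_elements:
  assumes "subgroup p'_elements G" shows "coprime (card p'_elements) p"
proof (rule ccontr)
  assume "\<not> coprime (card p'_elements) p"
  hence dvd: "p dvd card p'_elements" using prime_p by (metis coprime_commute prime_imp_coprime)
  interpret N: finite_group_prime "G\<lparr>carrier := p'_elements\<rparr>" p
    using assms by (rule restrict_finite_group_prime)
  obtain T where T: "Sylow_subgroup p T (G\<lparr>carrier := p'_elements\<rparr>)" using N.Sylow_exists by blast
  have "multiplicity p (card p'_elements) > 0"
    using dvd prime_p card_subgroup_pos[OF assms] by (simp add: prime_multiplicity_gt_zero_iff)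
  hence "card T \<noteq> 1" using T prime_gt_1_nat[OF prime_p] by (simp add: Sylow_subgroup_def order_def)
  moreover have "T = {\<one>}"
  proof -
    have "x = \<one>" if x: "x \<in> T" for x
    proof -
      have xM: "x \<in> p'_elements" using T x subgroup.subset by (fastforce simp: Sylow_subgroup_def)
      obtain k where "N.ord x = p ^ k" using N.ord_p_power[OF N.Sylow_p_subgroup[OF T] x] by blast
      hence k: "ord x = p ^ k" using assms by (simp add: ord_restrict)
      hence "coprime (p ^ k) p" using xM by (simp add: p'_elements_def)
      hence "k = 0" using coprime_p_power_iff by blast
      thus ?thesis using k ord_eq_1[of x] xM by (simp add: p'_elements_def)
    qed
    moreover have "\<one> \<in> T" using T by (auto simp: Sylow_subgroup_def dest: subgroup.one_closed)
    ultimately show ?thesis by blast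
  qed
  ultimately show False by simp
qed

lemma p_nilpotent_if_p'_elements_subgroup:
  assumes "subgroup p'_elements G" shows "p_nilpotent p G"
proof -
  obtain S where S: "Sylow_subgroup p S G" using Sylow_exists by blast
  have le: "p'_elements \<subseteq> O_p' p G"
    using assms by (intro O_p'_greatest(3) p'_elements_normal coprime_card_p'_elements) auto
  have "carrier G = p'_elements <#> S"
    using p'_elements_normal[OF assms] S
    by (intro normal_mult_Sylow_eq_carrier) (auto simp: p'_elements_def)
  hence "carrier G \<subseteq> O_p' p G <#> S" using mono_set_mult[OF le subset_refl] by blast
  moreover have "O_p' p G <#> S \<subseteq> carrier G"
    using S O_p'_greatest(1)[OF is_group finite_carrier, of p]
    by (intro setmult_subset_G) (auto simp: Sylow_subgroup_def subgroup.subset normal_imp_subgroup)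
  ultimately show ?thesis using S unfolding p_nilpotent_def by blast
qed

end

section \<open>Centric radical subgroups suffice\<close>

lemma (in group) conj_mem_normal_in_normalizer:
  assumes Q: "subgroup Q G" and R: "R \<lhd> G\<lparr>carrier := normalizer G Q\<rparr>"
    and x: "x \<in> normalizer G Q" and r: "r \<in> R"
  shows "x \<otimes> r \<otimes> inv x \<in> R"
  using normal.inv_op_closed2[OF R, of x r] x r m_inv_consistent[OF subgroup_normalizer[OF Q] x] by simp

lemma (in group) mem_conjugate_setI: "x \<in> U \<Longrightarrow> g \<otimes> x \<otimes> inv g \<in> conjugate_set G g U"
  by (simp add: conjugate_set_def)

context finite_group_prime
begin

lemma normal_in_normalizer_normalized:
  assumes Q: "subgroup Q G" and R: "R \<lhd> G\<lparr>carrier := normalizer G Q\<rparr>" and x: "x \<in> normalizer G Q"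
  shows "x \<in> normalizer G R"
proof -
  have N: "subgroup (normalizer G Q) G" using Q by (rule subgroup_normalizer)
  have RG: "subgroup R G" using incl_subgroup[OF N normal_imp_subgroup[OF R]] .
  have Rs: "R \<subseteq> carrier G" using RG by (rule subgroup.subset)
  have xG: "x \<in> carrier G" using N x by (rule subgroup.mem_carrier)
  have "conjugate_set G x R = R"
    by (rule conjugate_set_eqI[OF finite_carrier xG Rs]) (rule conj_mem_normal_in_normalizer[OF Q R x])
  thus ?thesis using xG Rs by (simp add: mem_normalizer_iff)
qed

text \<open>The preimage of \<open>O\<^sub>p(N\<^sub>G(Q)/Q)\<close> in \<open>N\<^sub>G(Q)\<close> is a normal \<open>p\<close>-subgroup containing \<open>Q\<close>
  and normalized by \<open>x\<close>. If it were larger than \<open>Q\<close>, then \<open>x\<close> would centralize it, and so \<open>Q\<close>.\<close>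

lemma p_radicalI_maximal:
  assumes Q: "p_subgroup p Q G" and x: "x \<in> normalizer G Q" "coprime (ord x) p" "x \<notin> centralizer G Q"
    and max: "\<And>R y. p_subgroup p R G \<Longrightarrow> card Q < card R \<Longrightarrow> y \<in> normalizer G R \<Longrightarrow>
      coprime (ord y) p \<Longrightarrow> y \<in> centralizer G R"
  shows "p_radical p Q G"
proof -
  have QG: "subgroup Q G" using Q by (simp add: p_subgroup_def)
  have N: "subgroup (normalizer G Q) G" using QG by (rule subgroup_normalizer)
  let ?N = "G\<lparr>carrier := normalizer G Q\<rparr>"
  interpret N: finite_group_prime ?N p using N by (rule restrict_finite_group_prime)
  have QN: "Q \<lhd> ?N" using QG by (rule subgroup_in_normalizer)
  interpret QN: normal Q ?N by (rule QN)
  interpret K: finite_group_prime "?N Mod Q" p using QN by (rule N.quotient_finite_group_prime)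
  define R0 where "R0 = O_p p (?N Mod Q)"
  have R0: "R0 \<lhd> ?N Mod Q" and pR0: "p_power_order p R0"
    unfolding R0_def using K.is_group K.finite_carrier prime_p by (auto intro: O_p_greatest)
  have R0s: "subgroup R0 (?N Mod Q)" using R0 by (rule normal_imp_subgroup)
  define R where "R = \<Union>R0"
  have R: "R \<lhd> ?N" unfolding R_def using R0 by (rule QN.factgroup_subgroup_union_normal)
  have RG: "subgroup R G" using incl_subgroup[OF N normal_imp_subgroup[OF R]] .
  have oneR0: "Q \<in> R0" using subgroup.one_closed[OF R0s] by simp
  hence QR: "Q \<subseteq> R" by (auto simp: R_def)
  have "R0 = rcosets\<^bsub>G\<lparr>carrier := R\<rparr>\<^esub> Q"
    using QN.factgroup_subgroup_union_factor[OF R0s] by (simp add: R_def)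
  moreover have "card (rcosets\<^bsub>G\<lparr>carrier := R\<rparr>\<^esub> Q) * card Q = card R"
    using group.lagrange[OF subgroup_imp_group[OF RG] subgroup_incl[OF QG RG QR]] by (simp add: order_def)
  ultimately have card: "card R0 * card Q = card R" by simp
  have pR: "p_subgroup p R G"
    using pR0 Q RG unfolding p_subgroup_def p_power_order_def card[symmetric]
    by (auto simp flip: power_add)
  have "R0 = {Q}"
  proof (rule ccontr)
    assume "R0 \<noteq> {Q}"
    have "finite R0" using finite_subset[OF subgroup.subset[OF R0s]] by simp
    hence "card R0 \<noteq> 1" "card R0 \<noteq> 0"
      using oneR0 \<open>R0 \<noteq> {Q}\<close> by (auto simp: card_1_singleton_iff)
    hence "card R0 * card Q > card Q" using card_subgroup_pos[OF QG] by simp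
    hence "x \<in> centralizer G R"
      using max[OF pR] card normal_in_normalizer_normalized[OF QG R x(1)] x(2) by simp
    thus False using x(3) centralizer_mono[OF QR] by blast
  qed
  thus ?thesis using Q by (simp add: p_radical_def p_reduced_def R0_def)
qed

text \<open>If \<open>Q\<close> is not centric, then a Sylow subgroup \<open>T\<close> of \<open>C\<^sub>G(Q)\<close> gives a larger \<open>p\<close>-subgroup
  \<open>Q T\<close>. By the Frattini argument \<open>x = c n\<close> with \<open>c\<close> in \<open>C\<^sub>G(Q)\<close> and \<open>n\<close> normalizing \<open>Q T\<close>.
  A power of \<open>n\<close> with exponent a power of \<open>p\<close> is a \<open>p'\<close>-element, so it centralizes \<open>Q T\<close>; hence
  the same power of \<open>x\<close>, and then \<open>x\<close> itself, centralizes \<open>Q\<close>.\<close>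

lemma p_centricI_maximal:
  assumes Q: "p_subgroup p Q G" and x: "x \<in> normalizer G Q" "coprime (ord x) p" "x \<notin> centralizer G Q"
    and max: "\<And>R y. p_subgroup p R G \<Longrightarrow> card Q < card R \<Longrightarrow> y \<in> normalizer G R \<Longrightarrow>
      coprime (ord y) p \<Longrightarrow> y \<in> centralizer G R"
  shows "p_centric p Q G"
proof -
  have QG: "subgroup Q G" using Q by (simp add: p_subgroup_def)
  have Qs: "Q \<subseteq> carrier G" using QG by (rule subgroup.subset)
  let ?C = "centralizer G Q" and ?NQ = "normalizer G Q"
  let ?N = "G\<lparr>carrier := ?NQ\<rparr>"
  have N: "subgroup ?NQ G" using QG by (rule subgroup_normalizer)
  have C: "subgroup ?C G" using Qs by (rule subgroup_centralizer)
  have CN: "?C \<lhd> ?N" using QG by (rule centralizer_normal_in_normalizer)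
  have CsN: "?C \<subseteq> ?NQ" using Qs by (rule centralizer_le_normalizer)
  interpret N: finite_group_prime ?N p using N by (rule restrict_finite_group_prime)
  interpret C: finite_group_prime "G\<lparr>carrier := ?C\<rparr>" p using C by (rule restrict_finite_group_prime)
  interpret CN: normal ?C ?N by (rule CN)
  let ?Z = "center (G\<lparr>carrier := Q\<rparr>)"
  have Z: "?Z = Q \<inter> ?C" using Qs by (auto simp: center_def centralizer_def)
  have ZG: "subgroup ?Z G" unfolding Z using QG C by (rule subgroups_Inter_pair)
  have "p_subgroup p ?Z (G\<lparr>carrier := ?C\<rparr>)"
    using p_subgroup_mono[OF Q ZG] subgroup_incl[OF ZG C] Z by (auto simp: p_subgroup_def)
  then obtain T where T: "Sylow_subgroup p T (G\<lparr>carrier := ?C\<rparr>)" and ZT: "?Z \<subseteq> T"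
    using C.p_subgroup_le_Sylow by blast
  have TC: "subgroup T (G\<lparr>carrier := ?C\<rparr>)" using T by (simp add: Sylow_subgroup_def)
  have TsC: "T \<subseteq> ?C" using subgroup.subset[OF TC] by simp
  have TG: "subgroup T G" using C TC by (rule incl_subgroup)
  have Ts: "T \<subseteq> carrier G" using TG by (rule subgroup.subset)
  have pT: "p_subgroup p T G"
    using C.Sylow_p_subgroup[OF T] TG by (simp add: p_subgroup_def)
  have "T \<subseteq> Q"
  proof (rule ccontr)
    assume notsub: "\<not> T \<subseteq> Q"
    have TN: "subgroup T ?N" using TG N TsC CsN by (intro subgroup_incl) auto
    have QN: "Q \<lhd> ?N" using QG by (rule subgroup_in_normalizer)
    define R where "R = Q <#> T"
    interpret QT: second_isomorphism_grp Q ?N T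
      using QN TN by (simp add: second_isomorphism_grp_def second_isomorphism_grp_axioms_def)
    have RN: "subgroup R ?N" using QT.normal_set_mult_subgroup by (simp add: R_def)
    have RG: "subgroup R G" using N RN by (rule incl_subgroup)
    have Rs: "R \<subseteq> carrier G" using RG by (rule subgroup.subset)
    have QR: "Q \<subseteq> R" and TR: "T \<subseteq> R"
      using QT.H_contained_in_set_mult QT.S_contained_in_set_mult by (simp_all add: R_def)
    obtain d where d: "d dvd card T" "card R = card Q * d"
      using N.card_normal_set_mult[OF _ QN TN] finite_subgroup[OF N] by (auto simp: R_def)
    have "p_power_order p R"
    proof -
      obtain i j where ij: "card Q = p ^ i" "card T = p ^ j"
        using Q pT by (auto simp: p_subgroup_def p_power_order_def)
      obtain k where "d = p ^ k" using d(1) ij(2) divides_primepow_nat[OF prime_p] by auto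
      thus ?thesis using d(2) ij(1) by (auto simp: p_power_order_def simp flip: power_add)
    qed
    hence pR: "p_subgroup p R G" using RG by (simp add: p_subgroup_def)
    have "Q \<subset> R" using QR TR notsub by blast
    hence cardR: "card Q < card R" using finite_subgroup[OF RG] by (simp add: psubset_card_mono)
    have xG: "x \<in> carrier G" using N x(1) by (rule subgroup.mem_carrier)
    have "Sylow_subgroup p (conjugate_set G x T) (G\<lparr>carrier := ?C\<rparr>)"
    proof -
      have "conjugate_set G x T \<subseteq> ?C"
        using TsC centralizer_conj_closed[OF Qs _ x(1)] by (auto simp: conjugate_set_def)
      thus ?thesis
        using T subgroup_incl[OF subgroup_conjugate_set[OF xG TG] C] card_conjugate_set[OF xG Ts]
        by (simp add: Sylow_subgroup_def)
    qed
    then obtain c where c: "c \<in> ?C" "conjugate_set G x T = conjugate_set G c T"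
      using C.Sylow_conjugate[OF T] C by (auto simp: conjugate_set_restrict)
    have cG: "c \<in> carrier G" using C c(1) by (rule subgroup.mem_carrier)
    define n where "n = inv c \<otimes> x"
    have nN: "n \<in> ?NQ"
      unfolding n_def using c(1) x(1) CsN N by (intro subgroup.m_closed subgroup.m_inv_closed) auto
    have nG: "n \<in> carrier G" using N nN by (rule subgroup.mem_carrier)
    have xcn: "x = c \<otimes> n" unfolding n_def using cG xG by (simp add: mult_inv_cancel)
    have "conjugate_set G n T = conjugate_set G (inv c) (conjugate_set G c T)"
      unfolding n_def using cG xG Ts c(2) by (simp add: conjugate_set_mult)
    also have "\<dots> = T" using cG Ts by (simp add: conjugate_set_one flip: conjugate_set_mult)
    finally have nT: "conjugate_set G n T = T" .
    have nQ: "conjugate_set G n Q = Q" using nN Qs by (simp add: mem_normalizer_iff)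
    have "n \<otimes> r \<otimes> inv n \<in> R" if r: "r \<in> R" for r
    proof -
      obtain a t where at: "a \<in> Q" "t \<in> T" "r = a \<otimes> t" using r by (auto simp: R_def set_mult_def)
      have aG: "a \<in> carrier G" and tG: "t \<in> carrier G" using at Qs Ts by auto
      have "n \<otimes> r \<otimes> inv n = (n \<otimes> a \<otimes> inv n) \<otimes> (n \<otimes> t \<otimes> inv n)"
        unfolding at(3) using nG aG tG by (simp add: conj_mult)
      moreover have "n \<otimes> a \<otimes> inv n \<in> Q" "n \<otimes> t \<otimes> inv n \<in> T"
        using mem_conjugate_setI[OF at(1), of n] mem_conjugate_setI[OF at(2), of n] nT nQ by auto
      ultimately show ?thesis unfolding R_def set_mult_def by blast
    qed
    hence nR: "n \<in> normalizer G R"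
      using nG Rs conjugate_set_eqI[OF finite_carrier nG Rs] by (simp add: mem_normalizer_iff)
    obtain a where a: "coprime (ord (n [^] (p ^ a))) p" using p'_element_pow[OF nG] by blast
    have "n [^] (p ^ a) \<in> normalizer G R"
    proof -
      interpret NR: group "G\<lparr>carrier := normalizer G R\<rparr>"
        using subgroup_normalizer[OF RG] by (rule subgroup_imp_group)
      show ?thesis using NR.nat_pow_closed[of n "p ^ a"] nR by (simp flip: nat_pow_consistent)
    qed
    hence "n [^] (p ^ a) \<in> centralizer G R" using max[OF pR cardR] a by blast
    hence nC: "n [^] (p ^ a) \<in> ?C" using centralizer_mono[OF QR] by blast
    have npow: "n [^] (p ^ a) \<in> ?NQ" using nC CsN by blast
    \<comment> \<open>Modulo \<open>C\<^sub>G(Q)\<close>, the elements \<open>x\<close> and \<open>n\<close> agree, so their powers do.\<close>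
    have "?C #>\<^bsub>?N\<^esub> x = ?C #>\<^bsub>?N\<^esub> n"
      using c(1) nN x(1) CsN xcn N.coset_mult_assoc[of ?C c n] N.coset_join2[of c ?C] CN.is_subgroup CN.subset
      by auto
    hence "?C #>\<^bsub>?N\<^esub> (x [^]\<^bsub>?N\<^esub> (p ^ a)) = ?C #>\<^bsub>?N\<^esub> (n [^]\<^bsub>?N\<^esub> (p ^ a))"
      using CN.FactGroup_pow[of x "p ^ a"] CN.FactGroup_pow[of n "p ^ a"] x(1) nN by simp
    also have "\<dots> = ?C"
      using nC npow N.coset_join2[of "n [^] (p ^ a)" ?C] CN.is_subgroup by (simp flip: nat_pow_consistent)
    finally have "x [^]\<^bsub>?N\<^esub> (p ^ a) \<in> ?C"
      using N.rcos_self[of "x [^]\<^bsub>?N\<^esub> (p ^ a)" ?C] N.nat_pow_closed[of x "p ^ a"] x(1) CN.is_subgroup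
      by simp
    hence "x [^] (p ^ a) \<in> ?C" by (simp flip: nat_pow_consistent)
    hence "x \<in> ?C" using p'_element_mem_of_pow[OF xG x(2) C] by blast
    thus False using x(3) by simp
  qed
  hence "T = ?Z" using ZT TsC Z by blast
  thus ?thesis using Q T by (simp add: p_centric_def)
qed

lemma frobenius_condition_if_centric_radical:
  assumes cr: "\<And>Q x. p_centric p Q G \<Longrightarrow> p_radical p Q G \<Longrightarrow> x \<in> normalizer G Q \<Longrightarrow>
    coprime (ord x) p \<Longrightarrow> x \<in> centralizer G Q"
  shows "frobenius_condition"
proof (rule ccontr)
  define bad where "bad Q \<longleftrightarrow> p_subgroup p Q G \<and>
    (\<exists>x \<in> normalizer G Q. coprime (ord x) p \<and> x \<notin> centralizer G Q)" for Q
  assume "\<not> frobenius_condition"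
  hence "\<exists>Q. bad Q" by (auto simp: frobenius_condition_def bad_def)
  moreover have "card Q \<le> order G" if "bad Q" for Q
    using that unfolding bad_def p_subgroup_def order_def
    by (intro card_mono) (auto dest: subgroup.subset)
  ultimately obtain Q where Q: "bad Q" and max: "\<And>R. bad R \<Longrightarrow> card R \<le> card Q"
    using ex_has_greatest_nat[of bad _ card "Suc (order G)"] by (metis less_Suc_eq_le)
  obtain x where x: "x \<in> normalizer G Q" "coprime (ord x) p" "x \<notin> centralizer G Q"
    using Q by (auto simp: bad_def)
  have pQ: "p_subgroup p Q G" using Q by (simp add: bad_def)
  have larger: "y \<in> centralizer G R"
    if "p_subgroup p R G" "card Q < card R" "y \<in> normalizer G R" "coprime (ord y) p" for R y
    using that max[of R] by (force simp: bad_def)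
  have "p_centric p Q G" using pQ x larger by (rule p_centricI_maximal)
  moreover have "p_radical p Q G" using pQ x larger by (rule p_radicalI_maximal)
  ultimately show False using cr x by blast
qed

end

section \<open>Sections\<close>

text \<open>Describes sections up to isomorphism, with \<open>K\<close> over any type. In this form sections of
  sections are sections, whereas a quotient of a quotient is a group of sets of sets.\<close>

definition is_section :: "('a, 'c) monoid_scheme \<Rightarrow> ('b, 'd) monoid_scheme \<Rightarrow> bool" where
  "is_section G K \<longleftrightarrow> (\<exists>A f. subgroup A G \<and> f \<in> hom (G\<lparr>carrier := A\<rparr>) K \<and> f ` A = carrier K)"

lemma sectionsE:
  assumes "group G" "K \<in> sections G"
  obtains A B where "subgroup A G" "B \<lhd> G\<lparr>carrier := A\<rparr>" "K = G\<lparr>carrier := A\<rparr> Mod B" "group K"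
proof -
  obtain A B where AB: "subgroup A G" "B \<lhd> G\<lparr>carrier := A\<rparr>" "K = G\<lparr>carrier := A\<rparr> Mod B"
    using assms(2) by (auto simp: sections_def)
  thus thesis using that normal.factorgroup_is_group[OF AB(2)] by blast
qed

lemma is_section_sections:
  assumes "group G" "K \<in> sections G" shows "is_section G K"
proof -
  obtain A B where AB: "subgroup A G" "B \<lhd> G\<lparr>carrier := A\<rparr>" "K = G\<lparr>carrier := A\<rparr> Mod B"
    using assms by (rule sectionsE)
  have "(\<lambda>a. B #>\<^bsub>G\<lparr>carrier := A\<rparr>\<^esub> a) \<in> hom (G\<lparr>carrier := A\<rparr>) K"
    unfolding AB(3) using AB(2) by (rule normal.r_coset_hom_Mod)
  moreover have "(\<lambda>a. B #>\<^bsub>G\<lparr>carrier := A\<rparr>\<^esub> a) ` A = carrier K"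
    unfolding AB(3) carrier_FactGroup by simp
  ultimately show ?thesis using AB(1) unfolding is_section_def by blast
qed

lemma is_section_finite:
  assumes "is_section G K" "finite (carrier G)" shows "finite (carrier K)"
  using assms unfolding is_section_def by (metis finite_imageI finite_subset subgroup.subset)

text \<open>The subgroup of \<open>G\<close> to use is the preimage of \<open>B\<close>.\<close>

lemma is_section_trans:
  assumes "group G" "group K" and GK: "is_section G K"
    and B: "subgroup B K" and h: "h \<in> hom (K\<lparr>carrier := B\<rparr>) L" "h ` B = carrier L"
  shows "is_section G L"
proof -
  interpret G: group G by fact
  interpret K: group K by fact
  obtain A f where A: "subgroup A G" and f: "f \<in> hom (G\<lparr>carrier := A\<rparr>) K" "f ` A = carrier K"
    using GK by (auto simp: is_section_def)
  interpret A: group "G\<lparr>carrier := A\<rparr>" using A by (rule G.subgroup_imp_group)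
  interpret f: group_hom "G\<lparr>carrier := A\<rparr>" K f using f(1) by unfold_locales
  define D where "D = {a \<in> A. f a \<in> B}"
  have DA: "subgroup D (G\<lparr>carrier := A\<rparr>)"
  proof (rule A.subgroupI)
    show "D \<subseteq> carrier (G\<lparr>carrier := A\<rparr>)" by (simp add: D_def)
    have "\<one>\<^bsub>G\<^esub> \<in> D"
      using subgroup.one_closed[OF A] subgroup.one_closed[OF B] f.hom_one by (simp add: D_def)
    thus "D \<noteq> {}" by blast
    fix a b assume a: "a \<in> D" and b: "b \<in> D"
    show "inv\<^bsub>G\<lparr>carrier := A\<rparr>\<^esub> a \<in> D"
      using a f.hom_inv[of a] A.inv_closed[of a] subgroup.m_inv_closed[OF B] by (simp add: D_def)
    show "a \<otimes>\<^bsub>G\<lparr>carrier := A\<rparr>\<^esub> b \<in> D"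
      using a b f.hom_mult[of a b] A.m_closed[of a b] subgroup.m_closed[OF B] by (simp add: D_def)
  qed
  have "B \<subseteq> f ` A" using f(2) subgroup.subset[OF B] by simp
  hence "f ` D = B" unfolding D_def by blast
  hence "(\<lambda>a. h (f a)) ` D = carrier L" using h(2) by (metis image_image)
  moreover have "(\<lambda>a. h (f a)) \<in> hom (G\<lparr>carrier := D\<rparr>) L"
    using h(1) f(1) by (simp add: hom_def D_def Pi_iff)
  moreover have "subgroup D G" using A DA by (rule G.incl_subgroup)
  ultimately show ?thesis unfolding is_section_def by blast
qed

lemma is_section_iso_sections:
  assumes "group G" "group K" "is_section G K"
  obtains K' h where "K' \<in> sections G" "h \<in> iso K K'"
proof -
  interpret G: group G by fact
  interpret K: group K by fact
  obtain A f where A: "subgroup A G" and f: "f \<in> hom (G\<lparr>carrier := A\<rparr>) K" "f ` A = carrier K"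
    using assms(3) by (auto simp: is_section_def)
  interpret A: group "G\<lparr>carrier := A\<rparr>" using A by (rule G.subgroup_imp_group)
  interpret f: group_hom "G\<lparr>carrier := A\<rparr>" K f using f(1) by unfold_locales
  let ?K' = "G\<lparr>carrier := A\<rparr> Mod kernel (G\<lparr>carrier := A\<rparr>) K f"
  have "(\<lambda>U. the_elem (f ` U)) \<in> iso ?K' K"
    using f.FactGroup_iso_set f(2) by simp
  moreover have "group ?K'" using f.normal_kernel by (rule normal.factorgroup_is_group)
  ultimately obtain h where "h \<in> iso K ?K'" using group.iso_set_sym by blast
  moreover have "?K' \<in> sections G" unfolding sections_def using A f.normal_kernel by blast
  ultimately show thesis using that by blast
qed

section \<open>Nontrivial coprime action on a normal \<open>p\<close>-subgroup\<close>

text \<open>The obstruction to \<open>p\<close>-nilpotency: a \<open>p'\<close>-element acts nontrivially on a normal \<open>p\<close>-subgroup.\<close>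

definition coprime_action :: "nat \<Rightarrow> ('a, 'b) monoid_scheme \<Rightarrow> 'a set \<Rightarrow> 'a \<Rightarrow> bool" where
  "coprime_action p K P x \<longleftrightarrow> P \<lhd> K \<and> p_power_order p P \<and> x \<in> carrier K \<and>
     coprime (group.ord K x) p \<and> (\<exists>a \<in> P. x \<otimes>\<^bsub>K\<^esub> a \<noteq> a \<otimes>\<^bsub>K\<^esub> x)"

lemma (in group_hom) card_image_subgroup_dvd:
  assumes P: "subgroup P G" shows "card (h ` P) dvd card P"
proof -
  interpret P: group "G\<lparr>carrier := P\<rparr>" using P by (rule G.subgroup_imp_group)
  interpret hP: group_hom "G\<lparr>carrier := P\<rparr>" "H\<lparr>carrier := h ` P\<rparr>" h using P by (rule induced_group_hom)
  let ?k = "kernel (G\<lparr>carrier := P\<rparr>) (H\<lparr>carrier := h ` P\<rparr>) h"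
  have "(G\<lparr>carrier := P\<rparr> Mod ?k) \<cong> H\<lparr>carrier := h ` P\<rparr>" by (rule hP.FactGroup_iso) simp
  hence "card (h ` P) = card (rcosets\<^bsub>G\<lparr>carrier := P\<rparr>\<^esub> ?k)"
    using iso_same_order by (fastforce simp: order_def FactGroup_def is_iso_def)
  thus ?thesis using P.lagrange[OF hP.subgroup_kernel] by (simp add: order_def) (metis dvd_triv_left)
qed

text \<open>A surjective homomorphism preserves everything except possibly the nontriviality of the action.\<close>

lemma coprime_action_image:
  assumes "group_hom G H h" "h ` carrier G = carrier H" "finite (carrier G)" "Factorial_Ring.prime p"
    and act: "coprime_action p G P x" and a: "a \<in> P" "h (x \<otimes>\<^bsub>G\<^esub> a) \<noteq> h (a \<otimes>\<^bsub>G\<^esub> x)"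
  shows "coprime_action p H (h ` P) (h x)"
proof -
  interpret group_hom G H h by fact
  have P: "P \<lhd> G" and pP: "p_power_order p P" and x: "x \<in> carrier G" "coprime (G.ord x) p"
    using act by (auto simp: coprime_action_def)
  have PG: "subgroup P G" using P by (rule normal_imp_subgroup)
  have aG: "a \<in> carrier G" using PG a(1) by (rule subgroup.mem_carrier)
  have "h ` P \<lhd> H" using P group_hom_axioms assms(2) by (rule normal.surj_hom_normal_subgroup)
  moreover have "p_power_order p (h ` P)"
    using pP card_image_subgroup_dvd[OF PG] divides_primepow_nat[OF assms(4)]
    by (auto simp: p_power_order_def)
  moreover have "coprime (H.ord (h x)) p"
    using ord_hom_dvd[OF x(1)] x(2) by (meson coprime_divisors dvd_refl)
  moreover have "h x \<otimes>\<^bsub>H\<^esub> h a \<noteq> h a \<otimes>\<^bsub>H\<^esub> h x" using a x aG by simp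
  ultimately show ?thesis using x(1) a(1) unfolding coprime_action_def
    by (intro conjI bexI[of _ "h a"]) auto
qed

text \<open>Brings a section over an arbitrary type back into \<open>sections G\<close>, where orders can be compared to
  find a minimal one.\<close>

lemma coprime_action_in_sections:
  assumes G: "group G" "finite (carrier G)" and p: "Factorial_Ring.prime p"
    and K: "group K" "is_section G K" and act: "coprime_action p K P x"
  obtains K' P' x' where "K' \<in> sections G" "coprime_action p K' P' x'" "order K' = order K"
proof -
  obtain K' h where K': "K' \<in> sections G" and h: "h \<in> iso K K'"
    using G(1) K by (rule is_section_iso_sections)
  have grp: "group K'" using G(1) K' by (rule sectionsE)
  have hom: "group_hom K K' h"
    using h K(1) grp by (auto simp: group_hom_def group_hom_axioms_def iso_def)
  have bij: "h ` carrier K = carrier K'" "inj_on h (carrier K)"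
    using h by (auto simp: iso_def bij_betw_def)
  obtain a where a: "a \<in> P" "x \<otimes>\<^bsub>K\<^esub> a \<noteq> a \<otimes>\<^bsub>K\<^esub> x" using act by (auto simp: coprime_action_def)
  have "a \<in> carrier K" "x \<in> carrier K"
    using act a(1) by (auto simp: coprime_action_def dest!: normal_imp_subgroup intro: subgroup.mem_carrier)
  hence "h (x \<otimes>\<^bsub>K\<^esub> a) \<noteq> h (a \<otimes>\<^bsub>K\<^esub> x)"
    using a(2) inj_onD[OF bij(2)] group.is_monoid[OF K(1)] by (metis monoid.m_closed)
  hence "coprime_action p K' (h ` P) (h x)"
    using hom bij(1) is_section_finite[OF K(2) G(2)] p act a(1) by (intro coprime_action_image)
  moreover have "order K' = order K" using h by (metis iso_same_order)
  ultimately show thesis using that K' by blast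
qed

lemma (in group) pow_group_exponent:
  assumes "finite (carrier G)" "g \<in> carrier G"
  shows "g [^] group_exponent G = \<one>"
proof -
  have "order G > 0 \<and> (\<forall>g \<in> carrier G. g [^] order G = \<one>)"
    using assms(1) pow_order_eq_1 order_gt_0_iff_finite by blast
  hence "group_exponent G > 0 \<and> (\<forall>g \<in> carrier G. g [^] group_exponent G = \<one>)"
    unfolding group_exponent_def by (rule LeastI)
  thus ?thesis using assms(2) by blast
qed

lemma (in group) ord_pow_dvd:
  assumes "x \<in> carrier G" shows "ord (x [^] (i::nat)) dvd ord x"
proof -
  have "(x [^] i) [^] ord x = \<one>"
    using assms pow_eq_id[OF assms, of "i * ord x"] by (simp add: nat_pow_pow)
  thus ?thesis using assms pow_eq_id[of "x [^] i" "ord x"] by simp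
qed

lemma (in group) centralizer_normal:
  assumes "P \<lhd> G" shows "centralizer G P \<lhd> G"
proof -
  have PG: "subgroup P G" using assms by (rule normal_imp_subgroup)
  have "carrier G \<subseteq> normalizer G P"
    using normal_imp_subgroup_normalizer[OF subgroup_self, of P] assms subgroup.subset by fastforce
  hence "normalizer G P = carrier G" using subgroup.subset[OF subgroup_normalizer[OF PG]] by blast
  thus ?thesis using centralizer_normal_in_normalizer[OF PG] by simp
qed

context finite_group_prime
begin

lemma p_element_p'_element_trivial:
  assumes "z \<in> carrier G" "ord z = p ^ k" "coprime (ord z) p" shows "z = \<one>"
  using assms coprime_p_power_iff ord_eq_1 by fastforce

text \<open>By induction \<open>x\<^sup>n a x\<^sup>-\<^sup>n = z\<^sup>n a\<close>. For \<open>n\<close> the order of \<open>x\<close> this gives \<open>z\<^sup>n = \<one>\<close>, so the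
  order of \<open>z\<close> is both a power of \<open>p\<close> and prime to \<open>p\<close>.\<close>

lemma p'_element_commutes_if_commutator_fixed:
  assumes G: "x \<in> carrier G" "a \<in> carrier G" "z \<in> carrier G"
    and x: "coprime (ord x) p" and z: "ord z = p ^ k"
    and xa: "x \<otimes> a = z \<otimes> a \<otimes> x" and xz: "x \<otimes> z = z \<otimes> x"
  shows "x \<otimes> a = a \<otimes> x"
proof -
  have pow: "x [^] n \<otimes> a = z [^] n \<otimes> a \<otimes> x [^] n" for n :: nat
  proof (induction n)
    case (Suc n)
    have "x [^] Suc n \<otimes> a = x [^] n \<otimes> (z \<otimes> a \<otimes> x)" using G xa by (simp add: m_assoc)
    also have "\<dots> = (x [^] n \<otimes> z) \<otimes> (a \<otimes> x)" using G by (simp add: m_assoc)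
    also have "\<dots> = (z \<otimes> x [^] n) \<otimes> (a \<otimes> x)" using G xz by (simp add: group_commutes_pow)
    also have "\<dots> = z \<otimes> (x [^] n \<otimes> a) \<otimes> x" using G by (simp add: m_assoc)
    also have "\<dots> = (z \<otimes> z [^] n) \<otimes> a \<otimes> (x [^] n \<otimes> x)"
      unfolding Suc.IH using G by (simp add: m_assoc)
    also have "z \<otimes> z [^] n = z [^] Suc n" using G by (metis nat_pow_Suc2)
    finally show ?case by simp
  qed (use G in simp)
  have "a = z [^] ord x \<otimes> a" using pow[of "ord x"] G by simp
  hence "z [^] ord x = \<one>" using G by (metis nat_pow_closed r_cancel_one')
  hence "ord z dvd ord x" using G pow_eq_id by blast
  hence "coprime (ord z) p" using x by (meson coprime_divisors dvd_refl)
  hence "z = \<one>" using G z by (intro p_element_p'_element_trivial)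
  thus ?thesis using xa G by simp
qed

lemma coprime_action_mono:
  assumes "coprime_action p G P x" "R \<lhd> G" "R \<subseteq> P" "a \<in> R" "x \<otimes> a \<noteq> a \<otimes> x"
  shows "coprime_action p G R x"
proof -
  have "subgroup P G" "subgroup R G"
    using assms(1,2) by (auto simp: coprime_action_def normal_imp_subgroup)
  hence "p_power_order p R"
    using assms(1,3) p_subgroup_mono by (auto simp: coprime_action_def p_subgroup_def)
  thus ?thesis using assms by (auto simp: coprime_action_def)
qed

end

text \<open>The situation in a section of least order that has a coprime action.\<close>

locale minimal_coprime_action = finite_group_prime +
  assumes acts: "\<exists>P x. coprime_action p G P x"
    and no_subgroup: "\<And>A P x. subgroup A G \<Longrightarrow> coprime_action p (G\<lparr>carrier := A\<rparr>) P x \<Longrightarrow> A = carrier G"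
    and no_quotient: "\<And>B P x. B \<lhd> G \<Longrightarrow> coprime_action p (G Mod B) P x \<Longrightarrow> B = {\<one>}"
begin

text \<open>Otherwise the action would remain nontrivial modulo \<open>B\<close>.\<close>

lemma commutator_mem_normal:
  assumes act: "coprime_action p G P x" and B: "B \<lhd> G" "B \<noteq> {\<one>}" and a: "a \<in> P"
  obtains z where "z \<in> P" "z \<in> B" "x \<otimes> a = z \<otimes> a \<otimes> x"
proof -
  have PN: "P \<lhd> G" and x: "x \<in> carrier G" using act by (auto simp: coprime_action_def)
  interpret P: normal P G by (rule PN)
  interpret B: normal B G by (rule B(1))
  interpret h: group_hom G "G Mod B" "\<lambda>g. B #> g"
    using B.factorgroup_is_group B.r_coset_hom_Mod by (auto simp: group_hom_def group_hom_axioms_def)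
  have aG: "a \<in> carrier G" using a by simp
  have eq: "B #> (x \<otimes> a) = B #> (a \<otimes> x)"
  proof (rule ccontr)
    assume "B #> (x \<otimes> a) \<noteq> B #> (a \<otimes> x)"
    hence "coprime_action p (G Mod B) ((\<lambda>g. B #> g) ` P) (B #> x)"
      using h.group_hom_axioms a act prime_p by (intro coprime_action_image) (auto simp: carrier_FactGroup)
    thus False using no_quotient B by blast
  qed
  define z where "z = x \<otimes> a \<otimes> inv x \<otimes> inv a"
  have zP: "z \<in> P" unfolding z_def using P.inv_op_closed2[OF x a] a by simp
  have zinv: "z = (x \<otimes> a) \<otimes> inv (a \<otimes> x)" unfolding z_def using x aG by (simp add: m_assoc inv_mult_group)
  have "x \<otimes> a \<in> B #> (a \<otimes> x)" using eq x aG rcos_self[OF _ B.is_subgroup] by blast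
  hence "z \<in> B" unfolding zinv using x aG B.rcos_module_imp[OF is_group] by simp
  moreover have "x \<otimes> a = z \<otimes> a \<otimes> x" unfolding z_def using x aG by (simp add: m_assoc mult_inv_cancel)
  ultimately show thesis using zP that by blast
qed

text \<open>Otherwise all commutators \<open>z\<close> of \<open>x\<close> with elements of \<open>P\<close> lie in \<open>B\<close>, so \<open>x\<close> fixes them, and
  then \<open>x\<close> centralizes \<open>P\<close>.\<close>

lemma centralized_normal_trivial:
  assumes act: "coprime_action p G P x" and B: "B \<lhd> G"
    and cent: "\<And>z. z \<in> P \<Longrightarrow> z \<in> B \<Longrightarrow> x \<otimes> z = z \<otimes> x"
  shows "B = {\<one>}"
proof (rule ccontr)
  assume B1: "B \<noteq> {\<one>}"
  have P: "P \<lhd> G" "p_power_order p P" and x: "x \<in> carrier G" "coprime (ord x) p"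
    using act by (auto simp: coprime_action_def)
  have PG: "subgroup P G" using P(1) by (rule normal_imp_subgroup)
  obtain a where a: "a \<in> P" "x \<otimes> a \<noteq> a \<otimes> x" using act by (auto simp: coprime_action_def)
  obtain z where z: "z \<in> P" "z \<in> B" "x \<otimes> a = z \<otimes> a \<otimes> x"
    using commutator_mem_normal[OF act B B1 a(1)] .
  have "p_subgroup p P G" using P(2) PG by (simp add: p_subgroup_def)
  then obtain k where k: "ord z = p ^ k" using ord_p_power z(1) by blast
  have "x \<otimes> a = a \<otimes> x"
    using p'_element_commutes_if_commutator_fixed[OF x(1) _ _ x(2) k z(3) cent[OF z(1,2)]]
      subgroup.mem_carrier[OF PG a(1)] subgroup.mem_carrier[OF PG z(1)] by blast
  thus False using a(2) by simp
qed

text \<open>The intersection of \<open>O\<^sub>p\<^sub>'(G)\<close> and \<open>P\<close> is trivial, so \<open>x\<close> centralizes it.\<close>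

lemma p'_reduced_carrier: "p'_reduced p G"
proof -
  obtain P x where act: "coprime_action p G P x" using acts by blast
  have P: "P \<lhd> G" "p_power_order p P" and x: "x \<in> carrier G" using act by (auto simp: coprime_action_def)
  have PG: "subgroup P G" using P(1) by (rule normal_imp_subgroup)
  have pP: "p_subgroup p P G" using P(2) PG by (simp add: p_subgroup_def)
  note O = O_p'_greatest(1,2)[OF is_group finite_carrier, of p]
  have OG: "subgroup (O_p' p G) G" using O(1) by (rule normal_imp_subgroup)
  interpret O: group "G\<lparr>carrier := O_p' p G\<rparr>" using OG by (rule subgroup_imp_group)
  have "z = \<one>" if z: "z \<in> P" "z \<in> O_p' p G" for z
  proof -
    obtain k where k: "ord z = p ^ k" using ord_p_power[OF pP z(1)] by blast
    have "ord z dvd card (O_p' p G)"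
      using O.ord_dvd_group_order[of z] z(2) OG by (simp add: ord_restrict order_def)
    hence "coprime (ord z) p" using O(2) by (meson coprime_divisors dvd_refl)
    thus "z = \<one>" using k subgroup.mem_carrier[OF PG z(1)] by (intro p_element_p'_element_trivial)
  qed
  hence "O_p' p G = {\<one>}"
    using x by (intro centralized_normal_trivial[OF act O(1)]) (metis l_one r_one)
  thus ?thesis by (simp add: p'_reduced_def)
qed

text \<open>The centre of \<open>P\<close> is a nontrivial normal subgroup of \<open>G\<close>, so \<open>x\<close> does not centralize it, and it
  can replace \<open>P\<close>.\<close>

lemma abelian_coprime_action:
  obtains P x where "coprime_action p G P x" "\<And>a b. a \<in> P \<Longrightarrow> b \<in> P \<Longrightarrow> a \<otimes> b = b \<otimes> a"
proof -
  obtain P x where act: "coprime_action p G P x" using acts by blast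
  have P: "P \<lhd> G" "p_power_order p P" and x: "x \<in> carrier G" using act by (auto simp: coprime_action_def)
  have PG: "subgroup P G" using P(1) by (rule normal_imp_subgroup)
  interpret P: finite_group_prime "G\<lparr>carrier := P\<rparr>" p using PG by (rule restrict_finite_group_prime)
  let ?Z = "P \<inter> centralizer G P"
  have Z: "?Z \<lhd> G" using P(1) centralizer_normal[OF P(1)] by (rule normal_subgroup_intersect)
  have "P \<noteq> {\<one>}" using act by (auto simp: coprime_action_def)
  hence "center (G\<lparr>carrier := P\<rparr>) \<noteq> {\<one>}" using P.center_nontrivial P(2) by simp
  moreover have "center (G\<lparr>carrier := P\<rparr>) = ?Z"
    using subgroup.subset[OF PG] by (auto simp: center_def centralizer_def)
  ultimately have "?Z \<noteq> {\<one>}" by simp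
  then obtain a where a: "a \<in> ?Z" "x \<otimes> a \<noteq> a \<otimes> x"
    using centralized_normal_trivial[OF act Z] by blast
  have "coprime_action p G ?Z x" using act Z _ a by (rule coprime_action_mono) simp
  moreover have "a \<otimes> b = b \<otimes> a" if "a \<in> ?Z" "b \<in> ?Z" for a b
    using that unfolding centralizer_def by blast
  ultimately show thesis by (rule that)
qed

text \<open>The subgroup \<open>P \<langle>x\<rangle>\<close> already has the coprime action.\<close>

lemma carrier_eq_P_mult_powers:
  assumes act: "coprime_action p G P x" and g: "g \<in> carrier G"
  obtains a i where "a \<in> P" "g = a \<otimes> x [^] (i::nat)"
proof -
  have P: "P \<lhd> G" "p_power_order p P" and x: "x \<in> carrier G" "coprime (ord x) p"
    using act by (auto simp: coprime_action_def)
  let ?T = "generate G {x}"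
  have XG: "subgroup ?T G" using x(1) by (intro generate_is_subgroup) simp
  interpret second_isomorphism_grp P G ?T
    using P(1) XG by (simp add: second_isomorphism_grp_def second_isomorphism_grp_axioms_def)
  let ?A = "P <#> ?T"
  have A: "subgroup ?A G" by (rule normal_set_mult_subgroup)
  have "P \<lhd> G\<lparr>carrier := ?A\<rparr>" using A P(1) H_contained_in_set_mult by (rule normal_restrict_supergroup)
  moreover have "x \<in> ?A" using S_contained_in_set_mult generate.incl[of x "{x}" G] by blast
  ultimately have "coprime_action p (G\<lparr>carrier := ?A\<rparr>) P x"
    using act A by (simp add: coprime_action_def ord_restrict)
  hence "?A = carrier G" by (rule no_subgroup[OF A])
  hence "g \<in> ?A" using g by simp
  thus thesis using that generate_pow_on_finite_carrier[OF finite_carrier x(1)]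
    by (auto simp: set_mult_def)
qed

text \<open>Put \<open>y = x\<^sup>i\<close>. If \<open>y\<close> centralized \<open>P\<close>, it would be a nontrivial element of the centre of
  \<open>G = P \<langle>x\<rangle>\<close>; but \<open>x\<close> centralizes the centre, which is therefore trivial. Hence \<open>y\<close> acts
  nontrivially on \<open>P\<close>. The subgroup \<open>C\<^sub>P(y)\<close> is normal in \<open>G\<close>, since \<open>P\<close> is abelian and \<open>x\<close>
  commutes with \<open>y\<close>; it is centralized by \<open>y\<close> and so trivial.\<close>

lemma powers_act_fixed_point_freely:
  assumes act: "coprime_action p G P x" and ab: "\<And>a b. a \<in> P \<Longrightarrow> b \<in> P \<Longrightarrow> a \<otimes> b = b \<otimes> a"
    and y: "x [^] (i::nat) \<noteq> \<one>" and a: "a \<in> P" "x [^] i \<otimes> a = a \<otimes> x [^] i"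
  shows "a = \<one>"
proof -
  have P: "P \<lhd> G" "p_power_order p P" and x: "x \<in> carrier G" "coprime (ord x) p"
    using act by (auto simp: coprime_action_def)
  interpret P: normal P G by (rule P(1))
  define y where "y = x [^] i"
  have yG: "y \<in> carrier G" using x(1) by (simp add: y_def)
  have xy: "x [^] j \<otimes> y = y \<otimes> x [^] j" for j :: nat
    using x(1) by (simp add: y_def nat_pow_mult add.commute)
  have "ord y dvd ord x" unfolding y_def using x(1) by (rule ord_pow_dvd)
  hence y': "coprime (ord y) p" using x(2) by (meson coprime_divisors dvd_refl)
  have "\<exists>b \<in> P. y \<otimes> b \<noteq> b \<otimes> y"
  proof (rule ccontr)
    assume cent: "\<not> (\<exists>b \<in> P. y \<otimes> b \<noteq> b \<otimes> y)"
    have "y \<otimes> g = g \<otimes> y" if g: "g \<in> carrier G" for g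
    proof -
      obtain b j where bj: "b \<in> P" "g = b \<otimes> x [^] (j::nat)" using carrier_eq_P_mult_powers[OF act g] .
      have "b \<in> carrier G" using bj by simp
      hence "y \<otimes> g = (y \<otimes> b) \<otimes> x [^] j" using bj yG x(1) by (simp add: m_assoc)
      also have "\<dots> = b \<otimes> (y \<otimes> x [^] j)" using bj cent yG x(1) \<open>b \<in> carrier G\<close> by (simp add: m_assoc)
      also have "\<dots> = g \<otimes> y" using bj xy[of j] yG x(1) \<open>b \<in> carrier G\<close> by (simp add: m_assoc)
      finally show ?thesis .
    qed
    hence "y \<in> center G" using yG by (simp add: center_def centralizer_def)
    moreover have "center G = {\<one>}"
      using x(1) by (intro centralized_normal_trivial[OF act center_normal]) (simp add: center_def centralizer_def)
    ultimately show False using y by (simp add: y_def)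
  qed
  hence acty: "coprime_action p G P y" using P yG y' by (simp add: coprime_action_def)
  let ?C = "P \<inter> centralizer G {y}"
  have "?C \<lhd> G"
  proof (rule normal_invI)
    show "subgroup ?C G" using P.is_subgroup subgroup_centralizer[of "{y}"] yG
      by (intro subgroups_Inter_pair) auto
    fix g c assume g: "g \<in> carrier G" and c: "c \<in> ?C"
    have cG: "c \<in> carrier G" "c \<in> P" "c \<otimes> y = y \<otimes> c" using c by (auto simp: centralizer_def)
    obtain b j where bj: "b \<in> P" "g = b \<otimes> x [^] (j::nat)" using carrier_eq_P_mult_powers[OF act g] .
    have bG: "b \<in> carrier G" using bj by simp
    let ?u = "x [^] j"
    have uG: "?u \<in> carrier G" using x(1) by simp
    have d: "?u \<otimes> c \<otimes> inv ?u \<in> P" using uG cG(2) by (rule P.inv_op_closed2)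
    have "g \<otimes> c \<otimes> inv g = b \<otimes> (?u \<otimes> c \<otimes> inv ?u) \<otimes> inv b"
      unfolding bj(2) using bG uG cG(1) by (simp add: m_assoc inv_mult_group)
    also have "\<dots> = ?u \<otimes> c \<otimes> inv ?u"
      using ab[OF bj(1) d] bG P.mem_carrier[OF d] conj_eq_self_iff by blast
    finally have eq: "g \<otimes> c \<otimes> inv g = ?u \<otimes> c \<otimes> inv ?u" .
    have "{?u, c} \<subseteq> centralizer G {y}" using xy[of j] uG cG by (auto simp: centralizer_def)
    moreover have "subgroup (centralizer G {y}) G" using subgroup_centralizer[of "{y}"] yG by simp
    ultimately have "?u \<otimes> c \<otimes> inv ?u \<in> centralizer G {y}"
      by (simp add: subgroup.m_closed subgroup.m_inv_closed)
    thus "g \<otimes> c \<otimes> inv g \<in> ?C" using eq d by simp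
  qed
  hence "?C = {\<one>}"
    by (rule centralized_normal_trivial[OF acty]) (simp add: centralizer_def)
  moreover have "a \<in> ?C" using a by (simp add: centralizer_def y_def)
  ultimately show ?thesis by simp
qed

text \<open>An element of order \<open>exp G\<close> has order divisible by \<open>p\<close> and by the order of \<open>x\<close>. It is
  \<open>a x\<^sup>i\<close> with \<open>x\<^sup>i\<close> nontrivial, since \<open>P\<close> has only \<open>p\<close>-elements; but then it commutes with one of
  its powers, of order \<open>p\<close> and lying in \<open>P\<close>, which \<open>x\<^sup>i\<close> therefore fixes although it acts without nontrivial fixed points.\<close>

lemma phi_eq_0: "phi G = 0"
proof -
  obtain P x where act: "coprime_action p G P x" and ab: "\<And>a b. a \<in> P \<Longrightarrow> b \<in> P \<Longrightarrow> a \<otimes> b = b \<otimes> a"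
    using abelian_coprime_action by blast
  have PN: "P \<lhd> G" "p_power_order p P" and x: "x \<in> carrier G" "coprime (ord x) p"
    using act by (auto simp: coprime_action_def)
  interpret P: normal P G by (rule PN(1))
  have pP: "p_subgroup p P G" using PN(2) P.is_subgroup by (simp add: p_subgroup_def)
  obtain a0 where a0: "a0 \<in> P" "x \<otimes> a0 \<noteq> a0 \<otimes> x" using act by (auto simp: coprime_action_def)
  have a0G: "a0 \<in> carrier G" using a0 by simp
  have "x \<noteq> \<one>" "a0 \<noteq> \<one>" using a0 a0G x(1) by auto
  have False if g: "g \<in> carrier G" "ord g = group_exponent G" for g
  proof -
    let ?e = "ord g"
    have dvd_e: "ord h dvd ?e" if "h \<in> carrier G" for h
      using that pow_group_exponent[OF finite_carrier that] g(2) pow_eq_id by simp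
    obtain k where k: "ord a0 = p ^ k" using ord_p_power[OF pP a0(1)] by blast
    have "k \<noteq> 0" using k \<open>a0 \<noteq> \<one>\<close> ord_eq_1[OF a0G] by auto
    hence p_dvd: "p dvd ?e" using k dvd_e[OF a0G] by (metis dvd_power dvd_trans not_gr_zero)
    obtain a i where ai: "a \<in> P" "g = a \<otimes> x [^] (i::nat)" using carrier_eq_P_mult_powers[OF act g(1)] .
    have aG: "a \<in> carrier G" using ai by simp
    have xi: "x [^] i \<noteq> \<one>"
    proof
      assume "x [^] i = \<one>"
      hence "g \<in> P" using ai aG by simp
      then obtain m where "?e = p ^ m" using ord_p_power[OF pP] by blast
      hence "ord x dvd p ^ m" using dvd_e[OF x(1)] by simp
      then obtain m' where m': "ord x = p ^ m'" using divides_primepow_nat[OF prime_p] by blast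
      hence "x = \<one>" using x by (intro p_element_p'_element_trivial)
      thus False using \<open>x \<noteq> \<one>\<close> by simp
    qed
    define w where "w = g [^] (?e div p)"
    have wG: "w \<in> carrier G" using g(1) by (simp add: w_def)
    have e0: "?e > 0" using ord_ge_1[OF finite_carrier g(1)] by simp
    have "w [^] p = g [^] ?e" using g(1) p_dvd by (simp add: w_def nat_pow_pow)
    hence wp: "w [^] p = \<one>" using g(1) by simp
    have "w \<noteq> \<one>"
    proof
      assume "w = \<one>"
      hence "?e dvd ?e div p" using pow_eq_id[OF g(1)] by (simp add: w_def)
      moreover have "?e div p < ?e" using e0 prime_gt_1_nat[OF prime_p] by simp
      moreover have "?e div p > 0" using e0 p_dvd by (metis dvd_div_eq_0_iff not_gr_zero)
      ultimately show False by (meson dvd_imp_le not_le)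
    qed
    have "w \<in> P"
    proof -
      obtain b j where bj: "b \<in> P" "w = b \<otimes> x [^] (j::nat)" using carrier_eq_P_mult_powers[OF act wG] .
      let ?u = "x [^] j"
      have bG: "b \<in> carrier G" and uG: "?u \<in> carrier G" using bj x(1) by auto
      have "P #> w = P #> ?u"
        using bj bG uG by (simp add: coset_mult_assoc[symmetric] coset_join2 P.is_subgroup P.subset)
      hence "P #> (?u [^] p) = P #> (w [^] p)"
        using P.FactGroup_pow[OF uG, of p] P.FactGroup_pow[OF wG, of p] by simp
      also have "\<dots> = P" using wp P.subset by simp
      finally have "?u [^] (p ^ 1) \<in> P" using uG rcos_self[of "?u [^] p" P] P.is_subgroup by simp
      moreover have "coprime (ord ?u) p"
      proof -
        have "ord ?u dvd ord x" using x(1) by (rule ord_pow_dvd)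
        thus ?thesis using x(2) by (meson coprime_divisors dvd_refl)
      qed
      ultimately have "?u \<in> P" using p'_element_mem_of_pow[OF uG _ P.is_subgroup] by blast
      thus ?thesis using bj by simp
    qed
    have "w \<otimes> g = g \<otimes> w" unfolding w_def using g(1) by (simp add: group_commutes_pow)
    hence "w \<otimes> a \<otimes> x [^] i = a \<otimes> x [^] i \<otimes> w" using ai wG aG x(1) by (simp add: m_assoc)
    hence "a \<otimes> (w \<otimes> x [^] i) = a \<otimes> (x [^] i \<otimes> w)"
      using ab[OF \<open>w \<in> P\<close> ai(1)] wG aG x(1) by (simp add: m_assoc)
    hence "x [^] i \<otimes> w = w \<otimes> x [^] i" using wG aG x(1) by simp
    hence "w = \<one>" using powers_act_fixed_point_freely[OF act ab xi \<open>w \<in> P\<close>] by blast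
    thus False using \<open>w \<noteq> \<one>\<close> by simp
  qed
  hence "{g \<in> carrier G. ord g = group_exponent G} = {}" by blast
  thus ?thesis by (simp add: phi_def)
qed

end

section \<open>The characterizations of \<open>p\<close>-nilpotency\<close>

text \<open>A section of least order among those with a coprime action is minimal, because its own sections
  are sections of \<open>G\<close>.\<close>

lemma exists_reduced_section_phi_eq_0:
  assumes G: "finite_group_prime G p" and act: "coprime_action p G P x"
  obtains K where "K \<in> sections G" "p'_reduced p K" "phi K = 0"
proof -
  interpret G: finite_group_prime G p by fact
  define bad where "bad K \<longleftrightarrow> K \<in> sections G \<and> (\<exists>P x. coprime_action p K P x)" for K
  have "is_section G G"
    unfolding is_section_def using G.subgroup_self by (intro exI[of _ "carrier G"] exI[of _ id]) (simp add: hom_def)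
  then obtain K0 where "bad K0"
    using coprime_action_in_sections[OF G.is_group G.finite_carrier G.prime_p G.is_group _ act]
    unfolding bad_def by metis
  then obtain K where K: "bad K" and min: "\<And>L. bad L \<Longrightarrow> order K \<le> order L"
    using ex_has_least_nat[of bad K0 order] by blast
  have KG: "K \<in> sections G" using K by (simp add: bad_def)
  have grpK: "group K" using G.is_group KG by (rule sectionsE)
  have secK: "is_section G K" using G.is_group KG by (rule is_section_sections)
  interpret K: group K by (rule grpK)
  interpret K: finite_group_prime K p
    using is_section_finite[OF secK G.finite_carrier] G.prime_p by unfold_locales
  interpret K: minimal_coprime_action K p
  proof unfold_locales
    show "\<exists>P x. coprime_action p K P x" using K by (simp add: bad_def)
  next
    fix A P x assume A: "subgroup A K" and actA: "coprime_action p (K\<lparr>carrier := A\<rparr>) P x"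
    have "(\<lambda>a. a) \<in> hom (K\<lparr>carrier := A\<rparr>) (K\<lparr>carrier := A\<rparr>)" by (simp add: hom_def)
    hence "is_section G (K\<lparr>carrier := A\<rparr>)"
      by (rule is_section_trans[OF G.is_group grpK secK A]) simp
    from coprime_action_in_sections[OF G.is_group G.finite_carrier G.prime_p K.subgroup_imp_group[OF A] this actA]
    obtain L where "bad L" "order L = order (K\<lparr>carrier := A\<rparr>)" unfolding bad_def by metis
    hence "card (carrier K) \<le> card A" using min by (fastforce simp: order_def)
    thus "A = carrier K" using subgroup.subset[OF A] by (simp add: card_seteq)
  next
    fix B P x assume B: "B \<lhd> K" and actB: "coprime_action p (K Mod B) P x"
    have "(\<lambda>a. B #>\<^bsub>K\<^esub> a) \<in> hom (K\<lparr>carrier := carrier K\<rparr>) (K Mod B)"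
      using normal.r_coset_hom_Mod[OF B] by simp
    hence "is_section G (K Mod B)"
      by (rule is_section_trans[OF G.is_group grpK secK K.subgroup_self]) (simp add: carrier_FactGroup)
    from coprime_action_in_sections[OF G.is_group G.finite_carrier G.prime_p
        normal.factorgroup_is_group[OF B] this actB]
    obtain L where "bad L" "order L = order (K Mod B)" unfolding bad_def by metis
    hence le: "order K \<le> order (K Mod B)" using min by fastforce
    have BK: "subgroup B K" using B by (rule normal_imp_subgroup)
    have "order (K Mod B) * card B = order K"
      using K.lagrange[OF BK] by (simp add: order_def FactGroup_def)
    moreover have "order K > 0" by (rule K.order_pos)
    ultimately have "card B \<le> 1" using le
      by (metis dual_order.strict_trans1 mult.right_neutral mult_le_cancel1 nat_0_less_mult_iff)
    moreover have "card B > 0" using BK by (rule K.card_subgroup_pos)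
    ultimately have "card B = 1" by simp
    thus "B = {\<one>\<^bsub>K\<^esub>}" using subgroup.one_closed[OF BK] by (metis card_1_singletonE singletonD)
  qed
  show thesis using that KG K.p'_reduced_carrier K.phi_eq_0 by blast
qed

text \<open>The orders of the elements are powers of \<open>p\<close>, so each divides the largest of them.\<close>

lemma phi_nonzero_if_p_exponent:
  fixes p :: nat
  assumes "group K" "finite (carrier K)" "Factorial_Ring.prime p"
    and pow: "\<And>g. g \<in> carrier K \<Longrightarrow> g [^]\<^bsub>K\<^esub> (p ^ n) = \<one>\<^bsub>K\<^esub>"
  shows "phi K \<noteq> 0"
proof -
  interpret group K by fact
  have ord_dvd: "ord g dvd p ^ n" if "g \<in> carrier K" for g using pow[OF that] pow_eq_id[OF that] by simp
  obtain g where g: "g \<in> carrier K" and max: "\<And>h. h \<in> carrier K \<Longrightarrow> ord h \<le> ord g"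
  proof -
    have "Max (ord ` carrier K) \<in> ord ` carrier K"
      using assms(2) carrier_not_empty by (intro Max_in) auto
    thus thesis using that Max_ge[of "ord ` carrier K"] assms(2) by force
  qed
  have "ord h dvd ord g" if h: "h \<in> carrier K" for h
  proof -
    obtain i where i: "ord h = p ^ i" using ord_dvd[OF h] divides_primepow_nat[OF assms(3)] by blast
    obtain j where j: "ord g = p ^ j" using ord_dvd[OF g] divides_primepow_nat[OF assms(3)] by blast
    have "i \<le> j" using max[OF h] i j prime_gt_1_nat[OF assms(3)] by simp
    thus ?thesis using i j by (simp add: le_imp_power_dvd)
  qed
  hence ann: "ord g > 0 \<and> (\<forall>h \<in> carrier K. h [^]\<^bsub>K\<^esub> ord g = \<one>\<^bsub>K\<^esub>)"
    using ord_ge_1[OF assms(2) g] pow_eq_id by auto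
  have "group_exponent K = ord g"
    unfolding group_exponent_def using ann
  proof (rule Least_equality)
    fix m :: nat assume m: "m > 0 \<and> (\<forall>h \<in> carrier K. h [^]\<^bsub>K\<^esub> m = \<one>\<^bsub>K\<^esub>)"
    hence "ord g dvd m" using g pow_eq_id by blast
    thus "ord g \<le> m" using m by (simp add: dvd_imp_le)
  qed
  hence "g \<in> {g \<in> carrier K. ord g = group_exponent K}" using g by simp
  moreover have "finite {g \<in> carrier K. ord g = group_exponent K}" using assms(2) by simp
  ultimately have "card {g \<in> carrier K. ord g = group_exponent K} \<noteq> 0" by (metis card_0_eq empty_iff)
  thus ?thesis by (simp add: phi_def)
qed

context finite_group_prime
begin

lemma p_nilpotent_pow_mem_O_p':
  assumes "p_nilpotent p G" obtains n where "\<And>x. x \<in> carrier G \<Longrightarrow> x [^] (p ^ n) \<in> O_p' p G"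
proof -
  have O: "O_p' p G \<lhd> G" using O_p'_greatest(1)[OF is_group finite_carrier] .
  obtain S where S: "Sylow_subgroup p S G" "carrier G = O_p' p G <#> S"
    using assms by (auto simp: p_nilpotent_def)
  have SG: "subgroup S G" using S(1) by (simp add: Sylow_subgroup_def)
  obtain d where d: "d dvd card S" "order G = card (O_p' p G) * d"
    using card_normal_set_mult[OF finite_carrier O SG] S(2) by (auto simp: order_def)
  have OG: "subgroup (O_p' p G) G" using O by (rule normal_imp_subgroup)
  have "order (G Mod O_p' p G) * card (O_p' p G) = order G"
    using lagrange[OF OG] by (simp add: order_def FactGroup_def)
  hence "order (G Mod O_p' p G) = d" using d(2) card_subgroup_pos[OF OG] by simp
  hence "order (G Mod O_p' p G) dvd p ^ multiplicity p (order G)"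
    using d(1) S(1) by (simp add: Sylow_subgroup_def)
  thus thesis using that pow_mem_of_order_quotient_dvd[OF O] by blast
qed

text \<open>The image of \<open>O\<^sub>p\<^sub>'(G) \<inter> A\<close> in a reduced section of \<open>G\<close> that comes from the subgroup \<open>A\<close> is
  trivial. As \<open>G/O\<^sub>p\<^sub>'(G)\<close> is a \<open>p\<close>-group, the section satisfies \<open>g [^] p\<^sup>n = \<one>\<close> for some \<open>n\<close>.\<close>

lemma p_nilpotent_imp_phi_nonzero:
  assumes nil: "p_nilpotent p G" and K: "K \<in> sections G" "p'_reduced p K"
  shows "phi K \<noteq> 0"
proof -
  let ?O = "O_p' p G"
  have O: "?O \<lhd> G" "coprime (card ?O) p" using O_p'_greatest(1,2)[OF is_group finite_carrier] .
  obtain n where n: "\<And>x. x \<in> carrier G \<Longrightarrow> x [^] (p ^ n) \<in> ?O"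
    using p_nilpotent_pow_mem_O_p'[OF nil] by blast
  have grpK: "group K" using is_group K(1) by (rule sectionsE)
  have sec: "is_section G K" using is_group K(1) by (rule is_section_sections)
  obtain A f where A: "subgroup A G" and f: "f \<in> hom (G\<lparr>carrier := A\<rparr>) K" "f ` A = carrier K"
    using sec by (auto simp: is_section_def)
  interpret A: finite_group_prime "G\<lparr>carrier := A\<rparr>" p using A by (rule restrict_finite_group_prime)
  interpret K: group K by (rule grpK)
  interpret f: group_hom "G\<lparr>carrier := A\<rparr>" K f using f(1) by unfold_locales
  have finK: "finite (carrier K)" using sec finite_carrier by (rule is_section_finite)
  let ?M = "?O \<inter> A"
  have M: "?M \<lhd> G\<lparr>carrier := A\<rparr>" using A O(1) by (rule normal_Int_subgroup)
  have MG: "subgroup ?M G" using incl_subgroup[OF A normal_imp_subgroup[OF M]] .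
  have "f ` ?M \<lhd> K"
    using M f.group_hom_axioms f(2) by (intro normal.surj_hom_normal_subgroup) auto
  moreover have "coprime (card (f ` ?M)) p"
  proof -
    have "card (f ` ?M) dvd card ?M" using normal_imp_subgroup[OF M] by (rule f.card_image_subgroup_dvd)
    moreover have "card ?M dvd card ?O"
      using MG normal_imp_subgroup[OF O(1)] by (rule card_subgroup_dvd_subgroup) simp
    ultimately show ?thesis using O(2) by (meson coprime_divisors dvd_refl dvd_trans)
  qed
  ultimately have triv: "f ` ?M \<subseteq> {\<one>\<^bsub>K\<^esub>}"
    using O_p'_greatest(3)[OF grpK finK] K(2) by (metis p'_reduced_def)
  show ?thesis
  proof (rule phi_nonzero_if_p_exponent[OF grpK finK prime_p])
    fix g assume "g \<in> carrier K"
    then obtain a where a: "a \<in> A" "g = f a" using f(2) by auto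
    have "a [^] (p ^ n) \<in> ?M"
      using n[OF subgroup.mem_carrier[OF A a(1)]] A.nat_pow_closed[of a "p ^ n"] a(1)
      by (simp flip: nat_pow_consistent)
    hence "f (a [^] (p ^ n)) = \<one>\<^bsub>K\<^esub>" using triv by blast
    thus "g [^]\<^bsub>K\<^esub> (p ^ n) = \<one>\<^bsub>K\<^esub>"
      using f.hom_nat_pow[of a "p ^ n"] a by (simp flip: nat_pow_consistent)
  qed
qed

lemma sections_restrict_subset:
  assumes H: "subgroup H G" shows "sections (G\<lparr>carrier := H\<rparr>) \<subseteq> sections G"
  using incl_subgroup[OF H] by (auto simp: sections_def)

lemma p_nilpotent_if_centric_radical:
  assumes phi: "\<And>Q K. p_centric p Q G \<Longrightarrow> p_radical p Q G \<Longrightarrow>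
    K \<in> sections (G\<lparr>carrier := normalizer G Q\<rparr>) \<Longrightarrow> p'_reduced p K \<Longrightarrow> phi K \<noteq> 0"
  shows "p_nilpotent p G"
proof -
  have "frobenius_condition"
  proof (rule frobenius_condition_if_centric_radical, rule ccontr)
    fix Q x assume Q: "p_centric p Q G" "p_radical p Q G"
      and x: "x \<in> normalizer G Q" "coprime (ord x) p" "x \<notin> centralizer G Q"
    have QG: "subgroup Q G" and pQ: "p_power_order p Q"
      using Q by (auto simp: p_centric_def p_subgroup_def)
    have N: "subgroup (normalizer G Q) G" using QG by (rule subgroup_normalizer)
    have "coprime_action p (G\<lparr>carrier := normalizer G Q\<rparr>) Q x"
      using subgroup_in_normalizer[OF QG] pQ x N subgroup.mem_carrier[OF N x(1)]
      by (auto simp: coprime_action_def centralizer_def ord_restrict)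
    then obtain K where "K \<in> sections (G\<lparr>carrier := normalizer G Q\<rparr>)" "p'_reduced p K" "phi K = 0"
      using exists_reduced_section_phi_eq_0[OF restrict_finite_group_prime[OF N]] by blast
    thus False using phi[OF Q] by blast
  qed
  hence "subgroup p'_elements G"
    using finite_group_prime_axioms by (intro frobenius_normal_complement)
  thus ?thesis by (rule p_nilpotent_if_p'_elements_subgroup)
qed

end

theorem theorem1p1:
  fixes G :: "('a, 'b) monoid_scheme" and p :: nat
  assumes "group G" and "finite (carrier G)" and "Factorial_Ring.prime p"
  shows "(p_nilpotent p G
            \<longleftrightarrow> (\<forall>K \<in> sections G. p'_reduced p K \<longrightarrow> phi K \<noteq> 0))
       \<and> (p_nilpotent p G
            \<longleftrightarrow> (\<forall>Q. p_centric p Q G \<longrightarrow>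
                  (\<forall>K \<in> sections (G\<lparr>carrier := normalizer G Q\<rparr>).
                     p'_reduced p K \<longrightarrow> phi K \<noteq> 0)))
       \<and> (p_nilpotent p G
            \<longleftrightarrow> (\<forall>Q. p_centric p Q G \<and> p_radical p Q G \<longrightarrow>
                  (\<forall>K \<in> sections (G\<lparr>carrier := normalizer G Q\<rparr>).
                     p'_reduced p K \<longrightarrow> phi K \<noteq> 0)))"
    (is "(?nil \<longleftrightarrow> ?all) \<and> (?nil \<longleftrightarrow> ?centric) \<and> (?nil \<longleftrightarrow> ?radical)")
proof -
  interpret finite_group_prime G p
    using assms by (simp add: finite_group_prime_def finite_group_prime_axioms_def)
  have "?nil \<Longrightarrow> ?all" using p_nilpotent_imp_phi_nonzero by blast
  moreover have "?all \<Longrightarrow> ?centric"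
    using sections_restrict_subset subgroup_normalizer by (auto simp: p_centric_def p_subgroup_def)
  moreover have "?centric \<Longrightarrow> ?radical" by blast
  moreover have "?radical \<Longrightarrow> ?nil" by (intro p_nilpotent_if_centric_radical) blast
  ultimately show ?thesis by argo
qed

end
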